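(* For every $p>2$ there exist constants $0<c\le C<\infty$ depending only on $p$ such that the following holds. Let $n\in\mathbb{N}$ and let $\Phi=(\varphi_j)_{j=1}^n$ be a sequence of mutually orthogonal (in $L^2$) real-valued functions on a probability space satisfying $\|\varphi_j\|_{L^\infty}\le 1$ for each $j\in[n]$. Then there exists a subset $S\subset[n]$ with $c\,n^{2/p}\le |S|\le C\,n^{2/p}$ such that for any sequence of real coefficients $(a_i)_{i=1}^n$, $$\Big\|\sum_{i\in S}a_i\varphi_i\Big\|_{L^p}\le C\Big(\sum_{i\in S}|a_i|^2\Big)^{1/2}.$$
   Context: $[n]=\{1,\dots,n\}$ and $|S|$ denotes the number of elements of $S$. All $L^p$ norms are taken over the given probability space. *)

theory Defs
  imports "HOL-Probability.Essential_Supremum" "HOL-Probability.Probability_Measure"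
begin

text \<open>Both norms take values in \<open>[0, \<infinity>]\<close>, so that no junk value arises for a function outside
  the space. The case distinction is the usual convention that the \<open>1/p\<close>-th power of \<open>\<infinity>\<close>
  is \<open>\<infinity>\<close>.\<close>

definition Lp_norm :: "'a measure \<Rightarrow> real \<Rightarrow> ('a \<Rightarrow> real) \<Rightarrow> ennreal" where
  "Lp_norm M p f =
     (let I = (\<integral>\<^sup>+ x. ennreal (\<bar>f x\<bar> powr p) \<partial>M)
      in if I = \<infinity> then \<infinity> else ennreal (enn2real I powr (1 / p)))"

definition Linf_norm :: "'a measure \<Rightarrow> ('a \<Rightarrow> real) \<Rightarrow> ennreal" where
  "Linf_norm M f = esssup M (\<lambda>x. ennreal \<bar>f x\<bar>)"

text \<open>The Bochner integral below is a genuine inner product of \<open>L\<^sup>2\<close>: the functions are measurable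
  and essentially bounded on a probability space, hence their products are integrable.
  A function that vanishes almost everywhere is allowed.\<close>

definition bounded_orthogonal_system :: "nat \<Rightarrow> 'a measure \<Rightarrow> (nat \<Rightarrow> 'a \<Rightarrow> real) \<Rightarrow> bool" where
  "bounded_orthogonal_system n M \<phi> \<longleftrightarrow>
     (\<forall>j\<in>{1..n}. \<phi> j \<in> borel_measurable M) \<and>
     (\<forall>j\<in>{1..n}. Linf_norm M (\<phi> j) \<le> 1) \<and>
     (\<forall>i\<in>{1..n}. \<forall>j\<in>{1..n}. i \<noteq> j \<longrightarrow> (\<integral>x. \<phi> i x * \<phi> j x \<partial>M) = 0)"

text \<open>\<open>c\<close> and \<open>C\<close> work for every \<open>n\<close>, every probability space whose points are of type \<open>'a\<close>, and
  every bounded orthogonal system of length \<open>n\<close> on it.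

  HOL cannot quantify over \<open>'a\<close> inside a formula, so \<open>\<exists>c C. Lambda_p_constants TYPE('a) p c C\<close>
  alone would leave the constants free to depend on \<open>'a\<close>. To express that they depend on \<open>p\<close>
  only, one can require that they exist for one fixed type and that whatever constants work for
  that type work for every \<open>'a\<close>. A suitable fixed type is \<open>nat \<Rightarrow> real\<close>, the type of the joint
  distribution of a sequence of real functions.\<close>

definition Lambda_p_constants :: "'a itself \<Rightarrow> real \<Rightarrow> real \<Rightarrow> real \<Rightarrow> bool" where
  "Lambda_p_constants T p c C \<longleftrightarrow>
     (\<forall>(n::nat) (M::'a measure) (\<phi> :: nat \<Rightarrow> 'a \<Rightarrow> real).
        prob_space M \<longrightarrow> bounded_orthogonal_system n M \<phi> \<longrightarrow>
        (\<exists>S \<subseteq> {1..n}.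
           c * real n powr (2 / p) \<le> real (card S) \<and>
           real (card S) \<le> C * real n powr (2 / p) \<and>
           (\<forall>a :: nat \<Rightarrow> real.
              Lp_norm M p (\<lambda>x. \<Sum>i\<in>S. a i * \<phi> i x) \<le> ennreal (C * sqrt (\<Sum>i\<in>S. \<bar>a i\<bar>\<^sup>2)))))"

end

theory Submission
  imports Defs
begin

text \<open>A uniformly random subset \<open>S\<close> of \<open>{1..n}\<close> with \<open>m = \<lfloor>n\<^sup>2\<^sup>/\<^sup>p\<rfloor>\<close> elements works with positive probability. Put
\<open>h = \<Sum>i\<in>S. a i * \<phi> i\<close> with \<open>\<Sum>i\<in>S. (a i)\<^sup>2 \<le> 1\<close>, let \<open>E\<close> be the set where \<open>h \<ge> T\<close> and \<open>u\<close> its probability.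
Averaging \<open>h\<close> over \<open>E\<close> and the Cauchy-Schwarz inequality give \<open>T\<^sup>2 \<le> \<Sum>i\<in>S. f\<^sub>i\<^sup>2\<close>, where \<open>f\<^sub>i\<close> is the mean of \<open>\<phi> i\<close>
over \<open>E\<close> (\<open>superlevel_square_le\<close>). So it suffices to control these sums for all events \<open>E\<close> at once, and
the bound to prove is \<open>\<Sum>i\<in>S. f\<^sub>i\<^sup>2 \<le> O((m / n) / u + (1 + ln (1/u))\<^sup>2)\<close> (\<open>exists_subset_small_energy\<close>). The
first term is the average over \<open>S\<close> of Bessel's inequality \<open>\<Sum>i\<le>n. f\<^sub>i\<^sup>2 \<le> 1/u\<close>. Solved for \<open>u\<close>, the bound says
that \<open>h\<close> has tails \<open>O((m / n) T\<^sup>-\<^sup>2 + T\<^sup>-\<^sup>p\<^sup>-\<^sup>1)\<close>. As \<open>\<bar>h\<bar> \<le> sqrt m\<close>, summation over dyadic \<open>T\<close> yields a \<open>p\<close>-th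
moment of order \<open>1 + m\<^sup>p\<^sup>/\<^sup>2 / n\<close>, which is bounded.

The difficulty is that there are too many events \<open>E\<close> for a union bound. It is met by an economical
description of the large coefficients \<open>f\<^sub>i\<close>. Approximate the normalised indicator of \<open>E\<close> greedily by
exponential tilts \<open>exp (\<Sum> c * \<phi> i)\<close>: whenever some coefficient of the current tilt differs from \<open>f\<^sub>i\<close> by more
than \<open>s\<close>, add \<open>\<plusminus> (s/2) \<phi> i\<close> to the exponent. Each step lowers the relative entropy, which is \<open>ln (1/u)\<close> at
the start, by at least \<open>s\<^sup>2 / 4\<close>. Running through \<open>s = 1, 1/2, 1/4, \<dots>\<close> gives words \<open>W l\<close> whose tilts have
coefficients within \<open>2\<^sup>-\<^sup>l\<close> of \<open>f\<^sub>i\<close> for all \<open>i \<le> n\<close>, with \<open>\<Sum>l. 4\<^sup>-\<^sup>l length (W l) = O(ln (1/u))\<close>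
(\<open>exists_multiscale_words\<close>). The words do not depend on \<open>S\<close>, and there are only \<open>n\<^sup>O\<^sup>(\<^sup>\<nu>\<^sup>)\<close> of length \<open>\<nu>\<close>.

So the set \<open>I\<close> of indices with \<open>\<bar>f\<^sub>i\<bar>\<close> above roughly \<open>2\<^sup>-\<^sup>l\<close> comes from a family of size \<open>n\<^sup>O\<^sup>(\<^sup>\<nu>\<^sup>)\<close>, \<open>\<nu> = length (W l)\<close>,
and a union bound with Poisson-type tails gives, for a random \<open>S\<close> and all such sets simultaneously, both
\<open>card (S \<inter> I) = O((m / n) card I + (\<nu> + 1) ln n)\<close> and \<open>card (S \<inter> I) = O(n\<^sup>\<epsilon> (m / n) card I + (\<nu> + 1) / \<epsilon>)\<close>
(\<open>exists_uniformly_sparse_subset\<close>). Multiplying by \<open>4\<^sup>-\<^sup>l\<close> and summing over \<open>l\<close> turns the terms with \<open>card I\<close>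
back into \<open>\<Sum>i\<le>n. f\<^sub>i\<^sup>2\<close> and the terms with \<open>\<nu>\<close> into \<open>O(1 + ln (1/u))\<close>. The second bound is used for
\<open>1/u \<le> n\<^sup>\<epsilon>\<close>; for smaller \<open>u\<close> the factor \<open>ln n\<close> of the first one is itself \<open>O(ln (1/u))\<close>.\<close>

section \<open>Random subsets meeting many sets in few points\<close>

lemma binomial_le_exp_power:
  assumes "0 < k"
  shows "real (N choose k) \<le> (exp 1 * real N / real k) ^ k"
proof -
  have "(\<lambda>j. real k ^ j / fact j) sums exp (real k)"
    using exp_converges[of "real k"] by (simp add: divide_inverse mult.commute)
  then have "real k ^ k / fact k \<le> exp (real k)"
    using sum_le_suminf[of "\<lambda>j. real k ^ j / fact j" "{k}"]
    by (simp add: sums_iff)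
  then have fact: "real k ^ k \<le> exp 1 ^ k * fact k"
    by (simp add: field_simps flip: exp_of_nat_mult)
  have "real (N choose k) * fact k \<le> real N ^ k"
  proof (cases "k \<le> N")
    case True
    have "(N choose k) * fact k * fact (N - k) = fact N"
      using binomial_fact_lemma[OF True] by (simp add: ac_simps)
    then have "fact N div fact (N - k) = (N choose k) * fact k"
      by (metis fact_nonzero nonzero_mult_div_cancel_right)
    then have "(N choose k) * fact k \<le> N ^ k"
      using fact_div_fact_le_pow[OF True] by simp
    then have "real ((N choose k) * fact k) \<le> real (N ^ k)"
      by (simp only: of_nat_le_iff)
    then show ?thesis by simp
  qed (simp add: binomial_eq_0)
  then have "real (N choose k) * fact k * real k ^ k \<le> real N ^ k * (exp 1 ^ k * fact k)"
    using fact by (intro mult_mono) auto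
  then have "real (N choose k) * real k ^ k \<le> real N ^ k * exp 1 ^ k"
    by simp
  then show ?thesis
    using assms by (simp add: power_divide power_mult_distrib le_divide_eq mult.commute)
qed

text \<open>Each further prescribed element of a random \<open>m\<close>-subset costs a factor
\<open>(m - k) / (n - k) \<le> m / n\<close>: sampling without replacement only lowers the probability.\<close>

lemma binomial_descend_le:
  assumes "k \<le> m" "m \<le> n" "0 < n"
  shows "real ((n - k) choose (m - k)) \<le> (real m / real n) ^ k * real (n choose m)"
  using assms
proof (induction k)
  case (Suc k)
  have pos: "0 < m - k" "0 < n - k" using Suc.prems by auto
  have "(m - k) * ((n - k) choose (m - k)) = (n - k) * ((n - Suc k) choose (m - Suc k))"
    using times_binomial_minus1_eq[OF pos(1), of "n - k"] by simp
  then have "real (m - k) * real ((n - k) choose (m - k))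
      = real (n - k) * real ((n - Suc k) choose (m - Suc k))"
    by (metis of_nat_mult)
  then have "real ((n - Suc k) choose (m - Suc k))
      = real (m - k) / real (n - k) * real ((n - k) choose (m - k))"
    using pos by (simp add: field_simps)
  also have "real (m - k) / real (n - k) \<le> real m / real n"
  proof -
    have "real k * real m \<le> real k * real n"
      using Suc.prems by (intro mult_left_mono) auto
    then have "(real m - real k) * real n \<le> real m * (real n - real k)"
      by (simp add: algebra_simps)
    then have "real (m - k) * real n \<le> real m * real (n - k)"
      using Suc.prems by (simp add: of_nat_diff)
    then show ?thesis
      using pos Suc.prems by (simp add: le_divide_eq divide_le_eq mult.commute)
  qed
  then have "real (m - k) / real (n - k) * real ((n - k) choose (m - k))
      \<le> real m / real n * ((real m / real n) ^ k * real (n choose m))"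
    using Suc by (intro mult_mono) auto
  finally show ?case by simp
qed simp

lemma card_supersets_of_card:
  assumes "finite V" "K \<subseteq> V" "card K \<le> m"
  shows "card {S. K \<subseteq> S \<and> S \<subseteq> V \<and> card S = m} = (card V - card K) choose (m - card K)"
proof -
  have fin: "finite K" using assms finite_subset by blast
  have "bij_betw (\<lambda>T. T \<union> K) {T. T \<subseteq> V - K \<and> card T = m - card K}
          {S. K \<subseteq> S \<and> S \<subseteq> V \<and> card S = m}"
  proof (rule bij_betw_byWitness[where f' = "\<lambda>S. S - K"])
    show "(\<lambda>T. T \<union> K) ` {T. T \<subseteq> V - K \<and> card T = m - card K}
        \<subseteq> {S. K \<subseteq> S \<and> S \<subseteq> V \<and> card S = m}"
    proof safe
      fix T assume T: "T \<subseteq> V - K" "card T = m - card K"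
      then have "finite T" using assms(1) finite_subset by blast
      then show "card (T \<union> K) = m"
        using T fin assms(3) by (subst card_Un_disjoint) auto
    qed (use assms in auto)
    show "(\<lambda>S. S - K) ` {S. K \<subseteq> S \<and> S \<subseteq> V \<and> card S = m}
        \<subseteq> {T. T \<subseteq> V - K \<and> card T = m - card K}"
      using fin by (auto simp: card_Diff_subset)
  qed auto
  then show ?thesis
    using assms fin
    by (simp add: bij_betw_same_card[symmetric] n_subsets card_Diff_subset)
qed

text \<open>A union bound over the \<open>k\<close>-subsets of \<open>J\<close>. When \<open>k\<close> exceeds the expected size of the intersection by
a factor \<open>e\<^sup>1\<^sup>+\<^sup>\<beta>\<close>, the right-hand side is at most a fraction \<open>e\<^sup>-\<^sup>\<beta>\<^sup>k\<close> of all \<open>m\<close>-subsets. The gain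
from a large \<open>\<beta>\<close> is what removes the logarithm from the final estimate.\<close>

lemma card_large_intersection_le:
  assumes "finite V" "J \<subseteq> V" "0 < k" "m \<le> card V" "0 < card V"
  shows "real (card {S. S \<subseteq> V \<and> card S = m \<and> k \<le> card (S \<inter> J)})
         \<le> (exp 1 * (real m / card V) * card J / k) ^ k * real (card V choose m)"
proof (cases "k \<le> m")
  case True
  let ?K = "{K. K \<subseteq> J \<and> card K = k}"
  have finJ: "finite J" using assms(1,2) finite_subset by blast
  have finV: "finite {S. K \<subseteq> S \<and> S \<subseteq> V \<and> card S = m}" for K
    by (rule finite_subset[of _ "Pow V"]) (use assms(1) in auto)
  have finK: "finite ?K" using finJ by simp
  have "{S. S \<subseteq> V \<and> card S = m \<and> k \<le> card (S \<inter> J)}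
        \<subseteq> (\<Union>K\<in>?K. {S. K \<subseteq> S \<and> S \<subseteq> V \<and> card S = m})"
  proof
    fix S assume S: "S \<in> {S. S \<subseteq> V \<and> card S = m \<and> k \<le> card (S \<inter> J)}"
    then have "k \<le> card (S \<inter> J)" by blast
    then obtain K where "K \<subseteq> S \<inter> J" "card K = k"
      by (rule obtain_subset_with_card_n)
    then show "S \<in> (\<Union>K\<in>?K. {S. K \<subseteq> S \<and> S \<subseteq> V \<and> card S = m})"
      using S by blast
  qed
  then have "card {S. S \<subseteq> V \<and> card S = m \<and> k \<le> card (S \<inter> J)}
      \<le> card (\<Union>K\<in>?K. {S. K \<subseteq> S \<and> S \<subseteq> V \<and> card S = m})"
    by (rule card_mono[OF finite_UN_I[OF finK finV]])
  also have "\<dots> \<le> (\<Sum>K\<in>?K. card {S. K \<subseteq> S \<and> S \<subseteq> V \<and> card S = m})"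
    using finK by (rule card_UN_le)
  also have "\<dots> = (\<Sum>K\<in>?K. (card V - k) choose (m - k))"
  proof (intro sum.cong refl)
    fix K assume K: "K \<in> ?K"
    then have "K \<subseteq> V" "card K \<le> m" using assms(2) True by auto
    with K show "card {S. K \<subseteq> S \<and> S \<subseteq> V \<and> card S = m} = (card V - k) choose (m - k)"
      using card_supersets_of_card[OF assms(1)] by simp
  qed
  also have "\<dots> = (card J choose k) * ((card V - k) choose (m - k))"
    using finJ by (simp add: n_subsets)
  finally have "real (card {S. S \<subseteq> V \<and> card S = m \<and> k \<le> card (S \<inter> J)})
      \<le> real (card J choose k) * real ((card V - k) choose (m - k))"
    by (simp only: of_nat_le_iff flip: of_nat_mult)
  also have "\<dots> \<le> (exp 1 * real (card J) / k) ^ k * ((real m / card V) ^ k * real (card V choose m))"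
    using binomial_le_exp_power[of k "card J"] binomial_descend_le[of k m "card V"] assms(3-5) True
    by (intro mult_mono) simp_all
  also have "\<dots> = (exp 1 * (real m / card V) * card J / k) ^ k * real (card V choose m)"
    by (simp add: power_mult_distrib power_divide ac_simps)
  finally show ?thesis .
next
  case False
  have "\<not> k \<le> card (S \<inter> J)" if "S \<subseteq> V" "card S = m" for S
  proof -
    have "card (S \<inter> J) \<le> card S"
      using finite_subset[OF that(1) assms(1)] by (intro card_mono) auto
    then show ?thesis using False that by simp
  qed
  then have "{S. S \<subseteq> V \<and> card S = m \<and> k \<le> card (S \<inter> J)} = {}"
    by blast
  then have "card {S. S \<subseteq> V \<and> card S = m \<and> k \<le> card (S \<inter> J)} = 0"
    by (metis card.empty)
  then show ?thesis by simp
qed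

lemma exists_subset_small_intersections:
  fixes J :: "'t \<Rightarrow> 'v set" and k :: "'t \<Rightarrow> nat"
  assumes V: "finite V" "0 < card V" "m \<le> card V" and T: "finite T"
    and J: "\<And>t. t \<in> T \<Longrightarrow> J t \<subseteq> V" and k: "\<And>t. t \<in> T \<Longrightarrow> 0 < k t"
    and small: "(\<Sum>t\<in>T. (exp 1 * (real m / card V) * card (J t) / k t) ^ k t) < 1"
  shows "\<exists>S\<subseteq>V. card S = m \<and> (\<forall>t\<in>T. card (S \<inter> J t) < k t)"
proof (rule ccontr)
  assume none: "\<not> ?thesis"
  let ?B = "\<lambda>t. {S. S \<subseteq> V \<and> card S = m \<and> k t \<le> card (S \<inter> J t)}"
  have pos: "0 < card V choose m" using V by simp
  have fin: "finite (?B t)" for t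
    by (rule finite_subset[of _ "Pow V"]) (use V in auto)
  have "{S. S \<subseteq> V \<and> card S = m} \<subseteq> (\<Union>t\<in>T. ?B t)"
  proof
    fix S assume S: "S \<in> {S. S \<subseteq> V \<and> card S = m}"
    then obtain t where "t \<in> T" "k t \<le> card (S \<inter> J t)"
      using none not_less by blast
    with S show "S \<in> (\<Union>t\<in>T. ?B t)" by blast
  qed
  then have "card {S. S \<subseteq> V \<and> card S = m} \<le> card (\<Union>t\<in>T. ?B t)"
    by (rule card_mono[OF finite_UN_I[OF T fin]])
  also have "\<dots> \<le> (\<Sum>t\<in>T. card (?B t))"
    using T by (rule card_UN_le)
  finally have "real (card V choose m) \<le> (\<Sum>t\<in>T. real (card (?B t)))"
    using V by (simp add: n_subsets flip: of_nat_sum)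
  also have "\<dots> \<le> (\<Sum>t\<in>T. (exp 1 * (real m / card V) * card (J t) / k t) ^ k t * real (card V choose m))"
    using V J k by (intro sum_mono card_large_intersection_le) auto
  also have "\<dots> = (\<Sum>t\<in>T. (exp 1 * (real m / card V) * card (J t) / k t) ^ k t) * real (card V choose m)"
    by (simp add: sum_distrib_right)
  also have "\<dots> < 1 * real (card V choose m)"
    using small pos by (intro mult_strict_right_mono) auto
  finally show False by simp
qed

text \<open>The index sets are labelled by a scale \<open>l\<close> and a word \<open>w\<close> over an alphabet of polynomial size, so
there are only \<open>n\<^sup>O\<^sup>(\<^sup>\<nu>\<^sup>)\<close> labels with words of length \<open>\<nu>\<close>. A random \<open>S\<close> violates the bound for one label
with probability at most \<open>n\<^sup>-\<^sup>6\<^sup>(\<^sup>\<nu>\<^sup>+\<^sup>1\<^sup>)\<close>, which a union bound can afford. The parameter \<open>\<beta>\<close> trades the two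
terms: \<open>\<beta> = 1\<close> keeps the density term sharp up to a constant and pays \<open>ln n\<close> per letter, while
\<open>\<beta> = \<epsilon> ln n\<close> pays a constant per letter and loses \<open>n\<^sup>\<epsilon>\<close> in the density term.\<close>

lemma exists_uniformly_sparse_subset:
  fixes A :: "'b set" and J :: "nat \<Rightarrow> 'b list \<Rightarrow> nat set" and B :: "real set"
  assumes n: "2 \<le> n" and m: "m \<le> n"
    and A: "finite A" "card A \<le> n ^ 3"
    and B: "finite B" "card B \<le> 2" "\<And>\<beta>. \<beta> \<in> B \<Longrightarrow> 0 < \<beta>"
    and J: "\<And>l w. J l w \<subseteq> {1..n}"
  shows "\<exists>S\<subseteq>{1..n}. card S = m \<and> (\<forall>\<beta>\<in>B. \<forall>l<n. \<forall>w\<in>lists A.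
           real (card (S \<inter> J l w))
           \<le> exp (1 + \<beta>) * (m / n) * card (J l w) + 6 * (length w + 1) * ln n / \<beta>)"
proof -
  define thr where "thr \<beta> l w = exp (1 + \<beta>) * (m / n) * card (J l w) + 6 * (length w + 1) * ln n / \<beta>"
    for \<beta> l w
  define k where "k = (\<lambda>(\<nu>::nat, \<beta>, l, w). Suc (nat \<lfloor>thr \<beta> l w\<rfloor>))"
  define J' where "J' = (\<lambda>(\<nu>::nat, \<beta>::real, l, w). J l w)"
  \<comment> \<open>For words of length at least \<open>N\<close> the asserted bound exceeds \<open>m\<close>, so finitely many words matter.\<close>
  obtain N :: nat where N: "real m * \<beta> \<le> real N" if "\<beta> \<in> B" for \<beta>
  proof -
    obtain N :: nat where N: "(\<Sum>\<beta>\<in>B. real m * \<beta>) \<le> real N"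
      using real_arch_simple by blast
    have "real m * \<beta> \<le> real N" if "\<beta> \<in> B" for \<beta>
      using member_le_sum[OF that, of "\<lambda>\<beta>. real m * \<beta>"] B N by (force simp: less_imp_le)
    then show thesis by (rule that)
  qed
  define T where "T = Sigma {..<N} (\<lambda>\<nu>. B \<times> {..<n} \<times> {w. set w \<subseteq> A \<and> length w = \<nu>})"
  have ln: "2 / 3 \<le> ln (real n)"
    using ln2_ge_two_thirds ln_le_cancel_iff[of 2 "real n"] n by linarith
  have bound: "(exp 1 * (m / n) * card (J' t) / k t) ^ k t \<le> (1 / real n ^ 6) ^ Suc \<nu>"
    if t: "t = (\<nu>, \<beta>, l, w)" "t \<in> T" for t \<nu> \<beta> l w
  proof -
    have \<beta>: "0 < \<beta>" and len: "length w = \<nu>" using t B by (auto simp: T_def)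
    have thr0: "0 \<le> exp (1 + \<beta>) * (m / n) * card (J l w)" by simp
    have thr1: "0 < 6 * (length w + 1) * ln n / \<beta>" using \<beta> ln by simp
    have kt: "thr \<beta> l w \<le> real (k t)"
      using of_nat_floor[of "thr \<beta> l w"] thr0 thr1 unfolding t k_def thr_def
      by simp linarith
    have kpos: "0 < real (k t)" by (simp add: t k_def)
    have "exp 1 * (m / n) * card (J' t) = exp (- \<beta>) * (exp (1 + \<beta>) * (m / n) * card (J l w))"
      by (simp add: J'_def t exp_minus exp_add field_simps)
    also have "\<dots> \<le> exp (- \<beta>) * real (k t)"
      using kt thr1 by (intro mult_left_mono) (auto simp: thr_def)
    finally have "exp 1 * (m / n) * card (J' t) / k t \<le> exp (- \<beta>)"
      using kpos by (subst pos_divide_le_eq)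
    then have "(exp 1 * (m / n) * card (J' t) / k t) ^ k t \<le> exp (- \<beta>) ^ k t"
      by (intro power_mono) auto
    also have "\<dots> = exp (- \<beta> * real (k t))"
      by (simp add: exp_of_nat_mult[symmetric] mult.commute)
    also have "\<dots> \<le> exp (- (6 * (length w + 1) * ln n))"
    proof -
      have "6 * (length w + 1) * ln n / \<beta> \<le> real (k t)"
        using kt thr0 unfolding thr_def by linarith
      then show ?thesis using \<beta> by (simp add: divide_le_eq mult.commute)
    qed
    also have "\<dots> = inverse (exp (ln (real n)) ^ (6 * Suc \<nu>))"
      by (simp add: len exp_of_nat_mult[symmetric] algebra_simps flip: exp_minus)
    also have "\<dots> = (1 / real n ^ 6) ^ Suc \<nu>"
      using n by (simp add: power_divide inverse_eq_divide power_mult[symmetric] del: power_Suc)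
    finally show ?thesis .
  qed
  have finW: "finite {w. set w \<subseteq> A \<and> length w = \<nu>}" for \<nu>
    using A by (simp add: finite_lists_length_eq)
  have finT: "finite T"
    unfolding T_def using finW B by (intro finite_SigmaI finite_cartesian_product) auto
  have "(\<Sum>t\<in>T. (exp 1 * (m / n) * card (J' t) / k t) ^ k t)
      \<le> (\<Sum>t\<in>T. (1 / real n ^ 6) ^ Suc (fst t))"
    using bound by (intro sum_mono) (metis prod_cases4 fst_conv)
  also have "\<dots> = (\<Sum>\<nu><N. \<Sum>t\<in>B \<times> {..<n} \<times> {w. set w \<subseteq> A \<and> length w = \<nu>}. (1 / real n ^ 6) ^ Suc \<nu>)"
    unfolding T_def using finW B by (subst sum.Sigma) (auto simp: case_prod_unfold)
  also have "\<dots> \<le> (\<Sum>\<nu><N. (1 / 16) * (1 / 2) ^ \<nu>)"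
  proof (intro sum_mono)
    fix \<nu>
    have "real (card (B \<times> {..<n} \<times> {w. set w \<subseteq> A \<and> length w = \<nu>}))
        = real (card B) * (real n * real (card A) ^ \<nu>)"
      using A by (simp add: card_cartesian_product card_lists_length_eq)
    also have "\<dots> \<le> 2 * (real n * (real n ^ 3) ^ \<nu>)"
      using A B by (intro mult_mono power_mono) (auto simp flip: of_nat_power)
    finally have "(\<Sum>t\<in>B \<times> {..<n} \<times> {w. set w \<subseteq> A \<and> length w = \<nu>}. (1 / real n ^ 6) ^ Suc \<nu>)
        \<le> 2 * (real n * (real n ^ 3) ^ \<nu>) * (1 / real n ^ 6) ^ Suc \<nu>"
      by (simp only: sum_constant) (intro mult_right_mono, auto)
    also have "\<dots> = 2 * (1 / real n ^ 5) * (1 / real n ^ 3) ^ \<nu>"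
    proof -
      have x: "x \<noteq> 0 \<Longrightarrow> x * (1 / x ^ 6) = 1 / x ^ 5" "x \<noteq> 0 \<Longrightarrow> x ^ 3 * (1 / x ^ 6) = 1 / x ^ 3"
        for x :: real
        by (simp_all add: eval_nat_numeral)
      have "2 * (real n * (real n ^ 3) ^ \<nu>) * (1 / real n ^ 6) ^ Suc \<nu>
          = 2 * (real n * (1 / real n ^ 6)) * (real n ^ 3 * (1 / real n ^ 6)) ^ \<nu>"
        by (simp only: power_mult_distrib power_Suc ac_simps)
      also have "\<dots> = 2 * (1 / real n ^ 5) * (1 / real n ^ 3) ^ \<nu>"
        using n by (simp only: x of_nat_eq_0_iff)
      finally show ?thesis .
    qed
    also have "\<dots> \<le> 2 * (1 / 2 ^ 5) * (1 / 2) ^ \<nu>"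
    proof (intro mult_mono power_mono)
      show "1 / real n ^ 5 \<le> 1 / 2 ^ 5"
        using n by (intro divide_left_mono power_mono) auto
      have "(2::real) ^ 3 \<le> real n ^ 3" using n by (intro power_mono) auto
      then have "1 / real n ^ 3 \<le> 1 / 2 ^ 3" using n by (intro divide_left_mono) auto
      then show "1 / real n ^ 3 \<le> 1 / 2" by simp
    qed auto
    finally show "(\<Sum>t\<in>B \<times> {..<n} \<times> {w. set w \<subseteq> A \<and> length w = \<nu>}. (1 / real n ^ 6) ^ Suc \<nu>)
        \<le> (1 / 16) * (1 / 2) ^ \<nu>" by simp
  qed
  also have "\<dots> = (1 / 16) * (\<Sum>\<nu><N. (1 / 2) ^ \<nu>)"
    by (simp add: sum_distrib_left)
  also have "\<dots> = (1 / 16) * (2 * (1 - (1 / 2) ^ N))"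
    by (simp add: sum_gp_strict)
  also have "\<dots> < 1" 
  proof -
    have *: "0 < q \<Longrightarrow> 1 / 16 * (2 * (1 - q)) < 1" for q :: real by simp
    show ?thesis by (rule *) simp
  qed
  finally have small: "(\<Sum>t\<in>T. (exp 1 * (m / card {1..n}) * card (J' t) / k t) ^ k t) < 1"
    by simp
  have "\<exists>S\<subseteq>{1..n}. card S = m \<and> (\<forall>t\<in>T. card (S \<inter> J' t) < k t)"
    using n m J finT small
    by (intro exists_subset_small_intersections) (auto simp: J'_def k_def)
  then obtain S where S: "S \<subseteq> {1..n}" "card S = m" "\<And>t. t \<in> T \<Longrightarrow> card (S \<inter> J' t) < k t"
    by blast
  have "real (card (S \<inter> J l w)) \<le> thr \<beta> l w"
    if \<beta>: "\<beta> \<in> B" and l: "l < n" and w: "w \<in> lists A" for \<beta> l w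
  proof -
    have thr0: "0 \<le> exp (1 + \<beta>) * (m / n) * card (J l w)" by simp
    have \<beta>0: "0 < \<beta>" using \<beta> B by simp
    show ?thesis
    proof (cases "length w < N")
      case True
      then have "(length w, \<beta>, l, w) \<in> T"
        using \<beta> l w by (auto simp: T_def in_lists_conv_set)
      from S(3)[OF this] have "card (S \<inter> J l w) \<le> nat \<lfloor>thr \<beta> l w\<rfloor>"
        by (simp add: J'_def k_def)
      moreover have "0 \<le> thr \<beta> l w"
        using thr0 \<beta>0 ln unfolding thr_def by (intro add_nonneg_nonneg) auto
      ultimately show ?thesis
        by (meson of_nat_floor of_nat_le_iff order_trans)
    next
      case False
      have "finite S" using S(1) finite_subset by blast
      then have "real (card (S \<inter> J l w)) \<le> real m"
        using S(2) by (simp add: card_mono flip: S(2))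
      also have "\<dots> \<le> real (length w) / \<beta>"
        using N[OF \<beta>] False \<beta>0 by (simp add: le_divide_eq)
      also have "\<dots> \<le> 6 * (length w + 1) * ln n / \<beta>"
      proof (intro divide_right_mono)
        have "real (length w) \<le> 6 * (real (length w) + 1) * (2 / 3)" by simp
        also have "\<dots> \<le> 6 * (real (length w) + 1) * ln n"
          using ln by (intro mult_left_mono) auto
        finally show "real (length w) \<le> 6 * (length w + 1) * ln n"
          by (simp add: algebra_simps)
      qed (use \<beta>0 in auto)
      finally show ?thesis using thr0 unfolding thr_def by linarith
    qed
  qed
  then show ?thesis
    using S(1,2) unfolding thr_def by blast
qed

section \<open>Greedy approximation by exponential tilts\<close>

lemma exp_le_quadratic:
  fixes x :: real
  assumes "\<bar>x\<bar> \<le> 1"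
  shows "exp x \<le> 1 + x + x\<^sup>2"
proof (cases "0 \<le> x")
  case True
  then show ?thesis using assms exp_bound by simp
next
  case False
  define y where "y = - x"
  have y: "0 \<le> y" using False by (simp add: y_def)
  have "(1 - y + y\<^sup>2) * (1 + y + y\<^sup>2 / 2) = 1 + (y ^ 2 + y ^ 3 + y ^ 4) / 2"
    by (simp add: field_simps power2_eq_square power3_eq_cube power4_eq_xxxx)
  then have "1 \<le> (1 - y + y\<^sup>2) * (1 + y + y\<^sup>2 / 2)"
    using y by simp
  also have "\<dots> \<le> (1 - y + y\<^sup>2) * exp y"
  proof (intro mult_left_mono)
    show "1 + y + y\<^sup>2 / 2 \<le> exp y" using y by (rule exp_lower_Taylor_quadratic)
    have "0 \<le> (y - 1 / 2)\<^sup>2" by simp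
    then show "0 \<le> 1 - y + y\<^sup>2" by (simp add: power2_eq_square algebra_simps)
  qed
  finally show ?thesis
    by (simp add: y_def exp_minus field_simps)
qed

locale bounded_orthogonal_family = prob_space M
  for M :: "'a measure" +
  fixes n :: nat and \<phi> :: "nat \<Rightarrow> 'a \<Rightarrow> real"
  assumes measurable_phi: "i \<in> {1..n} \<Longrightarrow> \<phi> i \<in> borel_measurable M"
    and abs_phi_le: "i \<in> {1..n} \<Longrightarrow> \<bar>\<phi> i x\<bar> \<le> 1"
    and orthogonal: "i \<in> {1..n} \<Longrightarrow> j \<in> {1..n} \<Longrightarrow> i \<noteq> j \<Longrightarrow> (\<integral>x. \<phi> i x * \<phi> j x \<partial>M) = 0"
begin

definition tilt :: "(real \<times> nat) list \<Rightarrow> 'a \<Rightarrow> real" where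
  "tilt w x = exp (\<Sum>(c, i)\<leftarrow>w. c * \<phi> i x)"

text \<open>The Fourier coefficients of the tilted probability density \<open>tilt w / \<integral> tilt w\<close>.\<close>

definition tilt_coeff :: "(real \<times> nat) list \<Rightarrow> nat \<Rightarrow> real" where
  "tilt_coeff w i = (\<integral>x. \<phi> i x * tilt w x \<partial>M) / (\<integral>x. tilt w x \<partial>M)"

text \<open>The Fourier coefficients of the normalised indicator of \<open>E\<close>.\<close>

definition cond_coeff :: "'a set \<Rightarrow> nat \<Rightarrow> real" where
  "cond_coeff E i = (\<integral>x. indicator E x * \<phi> i x \<partial>M) / prob E"

text \<open>Up to the additive constant \<open>- ln (prob E)\<close> this is the relative entropy of the normalised indicator
of \<open>E\<close> with respect to the tilted density. Written in this form it needs no entropy: it is an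
explicit function of the word.\<close>

definition potential :: "'a set \<Rightarrow> (real \<times> nat) list \<Rightarrow> real" where
  "potential E w = ln (\<integral>x. tilt w x \<partial>M) - (\<Sum>(c, i)\<leftarrow>w. c * cond_coeff E i)"

lemma integrable_bounded:
  fixes f :: "'a \<Rightarrow> real"
  assumes "f \<in> borel_measurable M" "\<And>x. \<bar>f x\<bar> \<le> B"
  shows "integrable M f"
  using assms by (intro integrable_const_bound[where B = B]) auto

lemma borel_measurable_combination:
  assumes "w \<in> lists (UNIV \<times> {1..n})"
  shows "(\<lambda>x. \<Sum>(c, i)\<leftarrow>w. c * \<phi> i x) \<in> borel_measurable M"
  using assms by (induction w) (auto intro!: borel_measurable_add borel_measurable_times measurable_phi)

lemma abs_combination_le:
  assumes "w \<in> lists (UNIV \<times> {1..n})"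
  shows "\<bar>\<Sum>(c, i)\<leftarrow>w. c * \<phi> i x\<bar> \<le> (\<Sum>(c, i)\<leftarrow>w. \<bar>c\<bar>)"
  using assms
proof (induction w)
  case (Cons a w)
  obtain c i where a: "a = (c, i)" by force
  have "i \<in> {1..n}" using Cons.hyps by (simp add: a)
  then have "\<bar>c * \<phi> i x\<bar> \<le> \<bar>c\<bar>"
    using abs_phi_le by (simp only: abs_mult mult_left_le abs_ge_zero)
  then show ?case using Cons by (simp add: a)
qed simp

lemma tilt_pos: "0 < tilt w x"
  by (simp add: tilt_def)

lemma tilt_Cons: "tilt ((c, i) # w) x = exp (c * \<phi> i x) * tilt w x"
  by (simp add: tilt_def exp_add)

lemma tilt_bounds:
  assumes "w \<in> lists (UNIV \<times> {1..n})"
  shows "tilt w x \<le> exp (\<Sum>(c, i)\<leftarrow>w. \<bar>c\<bar>)" "exp (- (\<Sum>(c, i)\<leftarrow>w. \<bar>c\<bar>)) \<le> tilt w x"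
  using abs_combination_le[OF assms, of x] by (auto simp: tilt_def)

lemma borel_measurable_tilt:
  assumes "w \<in> lists (UNIV \<times> {1..n})"
  shows "tilt w \<in> borel_measurable M"
  unfolding tilt_def[abs_def] using borel_measurable_combination[OF assms] by measurable

lemma integrable_tilt:
  assumes "w \<in> lists (UNIV \<times> {1..n})"
  shows "integrable M (tilt w)"
  using borel_measurable_tilt[OF assms] tilt_bounds(1)[OF assms] tilt_pos
  by (intro integrable_bounded[where B = "exp (\<Sum>(c, i)\<leftarrow>w. \<bar>c\<bar>)"]) (auto simp: less_imp_le)

lemma integrable_mult_tilt:
  assumes w: "w \<in> lists (UNIV \<times> {1..n})" and i: "i \<in> {1..n}"
  shows "integrable M (\<lambda>x. \<phi> i x * tilt w x)"
proof (rule integrable_bounded)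
  show "(\<lambda>x. \<phi> i x * tilt w x) \<in> borel_measurable M"
    using borel_measurable_tilt[OF w] measurable_phi[OF i] by measurable
  fix x
  show "\<bar>\<phi> i x * tilt w x\<bar> \<le> 1 * exp (\<Sum>(c, i)\<leftarrow>w. \<bar>c\<bar>)"
    unfolding abs_mult using tilt_bounds(1)[OF w] tilt_pos[of w x] abs_phi_le[OF i]
    by (intro mult_mono) auto
qed

lemma integral_tilt_pos:
  assumes "w \<in> lists (UNIV \<times> {1..n})"
  shows "0 < (\<integral>x. tilt w x \<partial>M)"
proof -
  have "exp (- (\<Sum>(c, i)\<leftarrow>w. \<bar>c\<bar>)) \<le> (\<integral>x. tilt w x \<partial>M)"
    using integrable_tilt[OF assms] tilt_bounds(2)[OF assms] by (intro integral_ge_const) auto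
  then show ?thesis by (rule less_le_trans[OF exp_gt_zero])
qed

lemma integrable_indicator_mult:
  fixes f :: "'a \<Rightarrow> real"
  assumes "E \<in> events" "f \<in> borel_measurable M" "\<And>x. \<bar>f x\<bar> \<le> B"
  shows "integrable M (\<lambda>x. indicator E x * f x)"
proof (rule integrable_bounded[where B = B])
  show "(\<lambda>x. indicator E x * f x) \<in> borel_measurable M"
    using assms by measurable
  show "\<bar>indicator E x * f x\<bar> \<le> B" for x
    using assms(3)[of x] by (auto simp: indicator_def)
qed

lemma abs_cond_coeff_le:
  assumes E: "E \<in> events" "0 < prob E" and i: "i \<in> {1..n}"
  shows "\<bar>cond_coeff E i\<bar> \<le> 1"
proof -
  have int: "integrable M (\<lambda>x. indicator E x * \<phi> i x)"
    using E i measurable_phi abs_phi_le by (intro integrable_indicator_mult) auto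
  have "\<bar>\<integral>x. indicator E x * \<phi> i x \<partial>M\<bar> \<le> (\<integral>x. \<bar>indicator E x * \<phi> i x\<bar> \<partial>M)"
    by (rule integral_abs_bound)
  also have "\<dots> \<le> (\<integral>x. indicator E x \<partial>M)"
  proof (intro integral_mono integrable_abs int)
    show "integrable M (indicator E :: 'a \<Rightarrow> real)"
      using E by (intro integrable_real_indicator) (auto simp: emeasure_eq_measure)
    show "\<bar>indicator E x * \<phi> i x\<bar> \<le> indicator E x" for x
      using abs_phi_le[OF i, of x] by (simp add: indicator_def)
  qed
  also have "\<dots> = prob E" using E by simp
  finally show ?thesis using E by (simp add: cond_coeff_def)
qed

lemma integral_indicator_combination:
  assumes E: "E \<in> events" "0 < prob E" and w: "w \<in> lists (UNIV \<times> {1..n})"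
  shows "(\<integral>x. indicator E x * (\<Sum>(c, i)\<leftarrow>w. c * \<phi> i x) \<partial>M)
         = prob E * (\<Sum>(c, i)\<leftarrow>w. c * cond_coeff E i)"
  using w
proof (induction w)
  case (Cons a w)
  obtain c i where a: "a = (c, i)" by force
  have i: "i \<in> {1..n}" and w: "w \<in> lists (UNIV \<times> {1..n})" using Cons.hyps a by auto
  have int1: "integrable M (\<lambda>x. indicator E x * \<phi> i x)"
    using E i measurable_phi abs_phi_le by (intro integrable_indicator_mult) auto
  have int2: "integrable M (\<lambda>x. indicator E x * (\<Sum>(c, i)\<leftarrow>w. c * \<phi> i x))"
    using E borel_measurable_combination[OF w] abs_combination_le[OF w]
    by (intro integrable_indicator_mult) auto
  have "(\<integral>x. indicator E x * (\<Sum>(c, i)\<leftarrow>a # w. c * \<phi> i x) \<partial>M)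
      = (\<integral>x. c * (indicator E x * \<phi> i x) + indicator E x * (\<Sum>(c, i)\<leftarrow>w. c * \<phi> i x) \<partial>M)"
    by (intro Bochner_Integration.integral_cong refl) (simp add: a algebra_simps)
  also have "\<dots> = c * (\<integral>x. indicator E x * \<phi> i x \<partial>M) + prob E * (\<Sum>(c, i)\<leftarrow>w. c * cond_coeff E i)"
    using int1 int2 Cons.IH w by simp
  finally show ?case using E by (simp add: a cond_coeff_def algebra_simps)
qed simp

text \<open>Jensen's inequality on \<open>E\<close>, i.e. nonnegativity of relative entropy. The tangent of \<open>exp\<close> at the
conditional mean \<open>b\<close> of the exponent gives it directly.\<close>

lemma potential_ge:
  assumes E: "E \<in> events" "0 < prob E" and w: "w \<in> lists (UNIV \<times> {1..n})"
  shows "ln (prob E) \<le> potential E w"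
proof -
  define H where "H x = (\<Sum>(c, i)\<leftarrow>w. c * \<phi> i x)" for x
  define b where "b = (\<Sum>(c, i)\<leftarrow>w. c * cond_coeff E i)"
  have intH: "integrable M (\<lambda>x. indicator E x * H x)"
    unfolding H_def using E borel_measurable_combination[OF w] abs_combination_le[OF w]
    by (intro integrable_indicator_mult) auto
  have intE: "integrable M (indicator E :: 'a \<Rightarrow> real)"
    using E by (intro integrable_real_indicator) (auto simp: emeasure_eq_measure)
  have "exp b * prob E = exp b * (1 - b) * prob E + exp b * (prob E * b)"
    by (simp add: algebra_simps)
  also have "\<dots> = (\<integral>x. exp b * (1 - b) * indicator E x + exp b * (indicator E x * H x) \<partial>M)"
    using intH intE integral_indicator_combination[OF E w] E by (simp add: H_def b_def)
  also have "\<dots> \<le> (\<integral>x. tilt w x \<partial>M)"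
  proof (intro integral_mono integrable_tilt w)
    show "integrable M (\<lambda>x. exp b * (1 - b) * indicator E x + exp b * (indicator E x * H x))"
      using intH intE by simp
    fix x
    have "exp b * (1 + (H x - b)) \<le> exp b * exp (H x - b)"
      by (intro mult_left_mono exp_ge_add_one_self) auto
    also have "\<dots> = tilt w x" by (simp add: tilt_def H_def flip: exp_add)
    finally show "exp b * (1 - b) * indicator E x + exp b * (indicator E x * H x) \<le> tilt w x"
      using tilt_pos[of w x] by (auto simp: indicator_def algebra_simps)
  qed
  finally have "ln (exp b * prob E) \<le> ln (\<integral>x. tilt w x \<partial>M)"
    using E by (subst ln_le_cancel_iff) (auto intro: integral_tilt_pos[OF w])
  then show ?thesis
    using E by (simp add: ln_mult potential_def b_def)
qed

lemma potential_Nil: "potential E [] = 0"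
  by (simp add: potential_def tilt_def prob_space)

text \<open>The derivative of the potential in the direction of \<open>\<phi> i\<close> is the difference of the two Fourier
coefficients, and the second order term is at most \<open>c\<^sup>2\<close> because \<open>\<bar>\<phi> i\<bar> \<le> 1\<close>.\<close>

lemma potential_Cons_le:
  assumes w: "w \<in> lists (UNIV \<times> {1..n})" and i: "i \<in> {1..n}" and c: "\<bar>c\<bar> \<le> 1"
  shows "potential E ((c, i) # w) \<le> potential E w + c * (tilt_coeff w i - cond_coeff E i) + c\<^sup>2"
proof -
  let ?Z = "\<integral>x. tilt w x \<partial>M"
  have Z: "0 < ?Z" by (rule integral_tilt_pos[OF w])
  have w': "(c, i) # w \<in> lists (UNIV \<times> {1..n})" using w i by simp
  have "(\<integral>x. tilt ((c, i) # w) x \<partial>M) \<le> (\<integral>x. (1 + c\<^sup>2) * tilt w x + c * (\<phi> i x * tilt w x) \<partial>M)"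
  proof (intro integral_mono integrable_tilt w')
    show "integrable M (\<lambda>x. (1 + c\<^sup>2) * tilt w x + c * (\<phi> i x * tilt w x))"
      using integrable_tilt[OF w] integrable_mult_tilt[OF w i] by simp
    fix x
    have phi: "\<bar>\<phi> i x\<bar> \<le> 1" by (rule abs_phi_le[OF i])
    have "\<bar>c * \<phi> i x\<bar> \<le> 1"
      using c phi by (simp add: abs_mult mult_le_one)
    then have "exp (c * \<phi> i x) \<le> 1 + c * \<phi> i x + (c * \<phi> i x)\<^sup>2"
      by (rule exp_le_quadratic)
    also have "(c * \<phi> i x)\<^sup>2 \<le> c\<^sup>2"
      using phi by (simp add: power_mult_distrib mult_left_le abs_square_le_1)
    finally have "exp (c * \<phi> i x) * tilt w x \<le> (1 + c * \<phi> i x + c\<^sup>2) * tilt w x"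
      using tilt_pos[of w x] by (intro mult_right_mono) auto
    then show "tilt ((c, i) # w) x \<le> (1 + c\<^sup>2) * tilt w x + c * (\<phi> i x * tilt w x)"
      by (simp add: tilt_Cons algebra_simps)
  qed
  also have "\<dots> = ?Z * (1 + (c * tilt_coeff w i + c\<^sup>2))"
    using integrable_tilt[OF w] integrable_mult_tilt[OF w i] Z
    by (simp add: tilt_coeff_def field_simps)
  also have "\<dots> \<le> ?Z * exp (c * tilt_coeff w i + c\<^sup>2)"
    using Z by (intro mult_left_mono exp_ge_add_one_self) auto
  finally have "ln (\<integral>x. tilt ((c, i) # w) x \<partial>M) \<le> ln (?Z * exp (c * tilt_coeff w i + c\<^sup>2))"
    using integral_tilt_pos[OF w'] Z by (subst ln_le_cancel_iff) auto
  then show ?thesis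
    using Z by (simp add: ln_mult potential_def algebra_simps)
qed

text \<open>The step size \<open>s / 2\<close> minimises \<open>c\<^sup>2 - c s\<close>.\<close>

lemma potential_decrease:
  assumes w: "w \<in> lists (UNIV \<times> {1..n})" and i: "i \<in> {1..n}" and s: "0 < s" "s \<le> 1"
    and far: "s < \<bar>cond_coeff E i - tilt_coeff w i\<bar>"
  shows "\<exists>c\<in>{s / 2, - (s / 2)}. potential E ((c, i) # w) \<le> potential E w - s\<^sup>2 / 4"
proof -
  define c where "c = (if tilt_coeff w i < cond_coeff E i then s / 2 else - (s / 2))"
  have "c * (tilt_coeff w i - cond_coeff E i) = - (s / 2) * \<bar>cond_coeff E i - tilt_coeff w i\<bar>"
    by (auto simp: c_def abs_if field_simps)
  also have "\<dots> \<le> - (s / 2) * s"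
    using far s by (intro mult_left_mono_neg) auto
  finally have "c * (tilt_coeff w i - cond_coeff E i) + c\<^sup>2 \<le> - s\<^sup>2 / 4"
    by (auto simp: c_def power2_eq_square split: if_splits)
  moreover have "potential E ((c, i) # w) \<le> potential E w + c * (tilt_coeff w i - cond_coeff E i) + c\<^sup>2"
    using s by (intro potential_Cons_le w i) (auto simp: c_def)
  ultimately have "potential E ((c, i) # w) \<le> potential E w - s\<^sup>2 / 4" by simp
  moreover have "c \<in> {s / 2, - (s / 2)}" by (simp add: c_def)
  ultimately show ?thesis by blast
qed

text \<open>Greedy approximation: as long as some coefficient is off by more than \<open>s\<close>, prepend a letter. The
potential is bounded below, so this stops.\<close>

lemma exists_refinement:
  assumes E: "E \<in> events" "0 < prob E" and w: "w \<in> lists (UNIV \<times> {1..n})" and s: "0 < s" "s \<le> 1"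
  shows "\<exists>v \<in> lists ({s / 2, - (s / 2)} \<times> {1..n}).
           (\<forall>i\<in>{1..n}. \<bar>cond_coeff E i - tilt_coeff (v @ w) i\<bar> \<le> s) \<and>
           potential E (v @ w) + s\<^sup>2 / 4 * length v \<le> potential E w"
proof (rule ccontr)
  assume none: "\<not> ?thesis"
  let ?A = "{s / 2, - (s / 2)} \<times> {1..n}"
  have long: "\<exists>v \<in> lists ?A. length v = k \<and> potential E (v @ w) + s\<^sup>2 / 4 * k \<le> potential E w" for k
  proof (induction k)
    case (Suc k)
    then obtain v where v: "v \<in> lists ?A" "length v = k"
      "potential E (v @ w) + s\<^sup>2 / 4 * k \<le> potential E w" by blast
    then obtain i where i: "i \<in> {1..n}" "s < \<bar>cond_coeff E i - tilt_coeff (v @ w) i\<bar>"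
      using none not_le by blast
    have "v @ w \<in> lists (UNIV \<times> {1..n})" using v(1) w by auto
    from potential_decrease[OF this i(1) s i(2)] obtain c
      where c: "c \<in> {s / 2, - (s / 2)}" "potential E ((c, i) # v @ w) \<le> potential E (v @ w) - s\<^sup>2 / 4"
      by blast
    have "(c, i) # v \<in> lists ?A" using c(1) i(1) v(1) by auto
    moreover have "potential E (((c, i) # v) @ w) + s\<^sup>2 / 4 * Suc k \<le> potential E w"
      using c(2) v(3) by (simp add: field_simps)
    ultimately show ?case using v(2) by (metis length_Cons)
  qed (auto intro!: bexI[of _ "[]"])
  obtain k :: nat where "(potential E w - ln (prob E)) / (s\<^sup>2 / 4) < k"
    using reals_Archimedean2 by blast
  then have k: "potential E w - ln (prob E) < s\<^sup>2 / 4 * k"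
    using s by (simp add: divide_less_eq mult.commute)
  obtain v where v: "v \<in> lists ?A" "potential E (v @ w) + s\<^sup>2 / 4 * k \<le> potential E w"
    using long[of k] by blast
  have "v @ w \<in> lists (UNIV \<times> {1..n})" using v(1) w by auto
  from potential_ge[OF E this] show False using v(2) k by linarith
qed

text \<open>All step sizes that the greedy procedure uses at the scales \<open>2\<^sup>-\<^sup>l\<close> with \<open>l \<le> k\<close>. The alphabet does not
depend on the set \<open>E\<close> that is approximated.\<close>

definition letters :: "nat \<Rightarrow> (real \<times> nat) set" where
  "letters k = {c. \<exists>l\<le>k. \<bar>c\<bar> = (1 / 2) ^ Suc l} \<times> {1..n}"

lemma letters_mono:
  assumes "k \<le> l"
  shows "letters k \<subseteq> letters l"
  unfolding letters_def
proof (intro Sigma_mono subsetI CollectI order_refl)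
  fix c :: real
  assume "c \<in> {c. \<exists>j\<le>k. \<bar>c\<bar> = (1 / 2) ^ Suc j}"
  then obtain j where "j \<le> k" "\<bar>c\<bar> = (1 / 2) ^ Suc j" by blast
  then show "\<exists>j\<le>l. \<bar>c\<bar> = (1 / 2) ^ Suc j" using assms by (intro exI[of _ j]) simp
qed

text \<open>The greedy procedure runs through the scales \<open>1, 1/2, 1/4, \<dots>\<close> and continues at each scale with the
word of the previous one. A letter at scale \<open>2\<^sup>-\<^sup>l\<close> lowers the potential by \<open>4\<^sup>-\<^sup>l / 4\<close>, and the total decrease
is at most \<open>ln (1 / prob E)\<close>. A letter chosen at scale \<open>l\<close> is counted again at every later scale, but
with geometrically decreasing weights. So all scales together cost no more than a single one.\<close>

lemma exists_multiscale_words: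
  assumes E: "E \<in> events" "0 < prob E"
  shows "\<exists>W. (\<forall>l. W l \<in> lists (letters l) \<and>
                (\<forall>i\<in>{1..n}. \<bar>cond_coeff E i - tilt_coeff (W l) i\<bar> \<le> (1 / 2) ^ l)) \<and>
             (\<forall>k. (\<Sum>l<k. (1 / 4) ^ l * length (W l)) \<le> 16 / 3 * ln (1 / prob E))"
proof -
  define P where "P l w \<longleftrightarrow> w \<in> lists (letters l) \<and>
    (\<forall>i\<in>{1..n}. \<bar>cond_coeff E i - tilt_coeff w i\<bar> \<le> (1 / 2) ^ l)" for l w
  define Q where "Q l w w' \<longleftrightarrow>
    potential E w' + (1 / 4) ^ l / 4 * (real (length w') - length w) \<le> potential E w" for l w w'
  have letters: "lists (letters l) \<subseteq> lists (UNIV \<times> {1..n})" for l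
    by (intro lists_mono) (auto simp: letters_def)
  have step: "\<exists>w'. P l w' \<and> Q l w w'" if w: "w \<in> lists (letters l)" for l w
  proof -
    have wU: "w \<in> lists (UNIV \<times> {1..n})" using w letters by blast
    obtain v where v: "v \<in> lists ({(1 / 2) ^ l / 2, - ((1 / 2) ^ l / 2)} \<times> {1..n})"
      "\<forall>i\<in>{1..n}. \<bar>cond_coeff E i - tilt_coeff (v @ w) i\<bar> \<le> (1 / 2) ^ l"
      "potential E (v @ w) + ((1 / 2) ^ l)\<^sup>2 / 4 * length v \<le> potential E w"
      using exists_refinement[OF E wU, of "(1 / 2) ^ l"] by (auto simp: power_le_one)
    have "v \<in> lists (letters l)"
      using v(1) by (rule lists_mono[THEN subsetD, rotated]) (auto simp: letters_def)
    moreover have "((1 / 2 :: real) ^ l)\<^sup>2 = (1 / 4) ^ l"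
      by (simp only: power2_eq_square flip: power_mult_distrib) simp
    ultimately have "P l (v @ w) \<and> Q l w (v @ w)"
      using v w by (simp add: P_def Q_def)
    then show ?thesis by blast
  qed
  obtain w0 where w0: "P 0 w0" "Q 0 [] w0" using step[of "[]" 0] by auto
  have "\<exists>w'. (P (Suc l) w' \<and> True) \<and> Q (Suc l) w w'" if "P l w \<and> True" for w l
  proof -
    have "letters l \<subseteq> letters (Suc l)" by (rule letters_mono) simp
    then have "w \<in> lists (letters (Suc l))" using that lists_mono by (auto simp: P_def)
    then show ?thesis using step by blast
  qed
  then obtain W where W0: "W 0 = w0" and W: "\<And>l. P l (W l)" "\<And>l. Q (Suc l) (W l) (W (Suc l))"
    using dependent_nat_choice[of "\<lambda>l w. P l w \<and> (l = 0 \<longrightarrow> w = w0)" "\<lambda>l. Q (Suc l)"] w0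
    by (metis nat.distinct(1))
  \<comment> \<open>Abel summation as an invariant: the second term carries the weight that the letters of \<open>W k\<close>
    will still contribute at the scales after \<open>k\<close>.\<close>
  have inv: "(\<Sum>l<Suc k. (1 / 4) ^ l * length (W l)) + (1 / 3) * ((1 / 4) ^ k * length (W k))
      \<le> - (16 / 3) * potential E (W k)" for k
  proof (induction k)
    case 0
    then show ?case using w0(2) by (simp add: W0 Q_def potential_Nil)
  next
    case (Suc k)
    define a b where "a = (1 / 4) ^ k * real (length (W (Suc k)))" and "b = (1 / 4) ^ k * real (length (W k))"
    have "potential E (W (Suc k)) + (a - b) / 16 \<le> potential E (W k)"
      using W(2)[of k] by (simp add: Q_def a_def b_def algebra_simps)
    moreover have "(\<Sum>l<Suc k. (1 / 4) ^ l * length (W l)) + b / 3 \<le> - (16 / 3) * potential E (W k)"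
      using Suc by (simp add: b_def)
    moreover have "(\<Sum>l<Suc (Suc k). (1 / 4) ^ l * length (W l)) = (\<Sum>l<Suc k. (1 / 4) ^ l * length (W l)) + a / 4"
      by (simp add: a_def)
    moreover have "(1 / 3) * ((1 / 4) ^ Suc k * length (W (Suc k))) = a / 12"
      by (simp add: a_def)
    moreover have "P' + (a - b) / 16 \<le> P \<Longrightarrow> S + b / 3 \<le> - (16 / 3) * P \<Longrightarrow> T = S + a / 4 \<Longrightarrow> u = a / 12
      \<Longrightarrow> T + u \<le> - (16 / 3) * P'" for P P' S T u :: real
      by (simp add: field_simps)
    ultimately show ?case by blast
  qed
  have "(\<Sum>l<k. (1 / 4) ^ l * length (W l)) \<le> 16 / 3 * ln (1 / prob E)" for k
  proof -
    have "(\<Sum>l<k. (1 / 4) ^ l * length (W l)) \<le> (\<Sum>l<Suc k. (1 / 4) ^ l * length (W l))"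
      by (intro sum_mono2) auto
    also have "\<dots> \<le> - (16 / 3) * potential E (W k)"
      using inv[of k] by (smt (verit) mult_nonneg_nonneg of_nat_0_le_iff zero_le_power divide_nonneg_nonneg)
    also have "\<dots> \<le> - (16 / 3) * ln (prob E)"
      using potential_ge[OF E, of "W k"] W(1)[of k] letters by (auto simp: P_def)
    finally show ?thesis using E by (simp add: ln_div)
  qed
  then show ?thesis using W(1) by (auto simp: P_def)
qed

text \<open>Bessel's inequality for functions of norm at most \<open>1\<close>: expand the square of
\<open>1\<^sub>E / prob E - (\<Sum>i. cond_coeff E i * \<phi> i)\<close>.\<close>

lemma sum_cond_coeff_squared_le:
  assumes E: "E \<in> events" "0 < prob E"
  shows "(\<Sum>i\<in>{1..n}. (cond_coeff E i)\<^sup>2) \<le> 1 / prob E"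
proof -
  define f where "f = cond_coeff E"
  define G where "G x = (\<Sum>i\<in>{1..n}. f i * \<phi> i x)" for x
  let ?q = "\<Sum>i\<in>{1..n}. (f i)\<^sup>2"
  have int2: "integrable M (\<lambda>x. \<phi> i x * \<phi> j x)" if "i \<in> {1..n}" "j \<in> {1..n}" for i j
    using measurable_phi[OF that(1)] measurable_phi[OF that(2)] abs_phi_le[OF that(1)] abs_phi_le[OF that(2)]
    by (intro integrable_bounded[where B = 1]) (auto simp: abs_mult mult_le_one)
  have intE: "integrable M (\<lambda>x. indicator E x * \<phi> i x)" if "i \<in> {1..n}" for i
    using E measurable_phi[OF that] abs_phi_le[OF that] by (intro integrable_indicator_mult) auto
  have G2: "(G x)\<^sup>2 = (\<Sum>i\<in>{1..n}. \<Sum>j\<in>{1..n}. f i * f j * (\<phi> i x * \<phi> j x))" for x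
    by (simp add: G_def power2_eq_square sum_product ac_simps)
  have intG2: "integrable M (\<lambda>x. (G x)\<^sup>2)"
    unfolding G2 using int2 by (intro Bochner_Integration.integrable_sum integrable_mult_right) auto
  have EG: "indicator E x * G x = (\<Sum>i\<in>{1..n}. f i * (indicator E x * \<phi> i x))" for x
    by (simp add: G_def sum_distrib_left ac_simps)
  have intEG: "integrable M (\<lambda>x. indicator E x * G x)"
    unfolding EG using intE by (intro Bochner_Integration.integrable_sum integrable_mult_right) auto
  have intI: "integrable M (indicator E :: 'a \<Rightarrow> real)"
    using E by (intro integrable_real_indicator) (auto simp: emeasure_eq_measure)
  have "(\<integral>x. (G x)\<^sup>2 \<partial>M) = (\<Sum>i\<in>{1..n}. \<Sum>j\<in>{1..n}. f i * f j * (\<integral>x. \<phi> i x * \<phi> j x \<partial>M))"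
  proof -
    have int: "integrable M (\<lambda>x. f i * f j * (\<phi> i x * \<phi> j x))" if "i \<in> {1..n}" "j \<in> {1..n}" for i j
      using int2[OF that] by (rule integrable_mult_right)
    have "(\<integral>x. (G x)\<^sup>2 \<partial>M) = (\<Sum>i\<in>{1..n}. \<integral>x. (\<Sum>j\<in>{1..n}. f i * f j * (\<phi> i x * \<phi> j x)) \<partial>M)"
      unfolding G2 using int by (intro Bochner_Integration.integral_sum Bochner_Integration.integrable_sum)
    also have "\<dots> = (\<Sum>i\<in>{1..n}. \<Sum>j\<in>{1..n}. \<integral>x. f i * f j * (\<phi> i x * \<phi> j x) \<partial>M)"
      using int by (intro sum.cong refl Bochner_Integration.integral_sum)
    finally show ?thesis by simp
  qed
  also have "\<dots> = (\<Sum>i\<in>{1..n}. (f i)\<^sup>2 * (\<integral>x. \<phi> i x * \<phi> i x \<partial>M))"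
  proof (intro sum.cong refl)
    fix i assume i: "i \<in> {1..n}"
    have "(\<Sum>j\<in>{1..n}. f i * f j * (\<integral>x. \<phi> i x * \<phi> j x \<partial>M))
        = (\<Sum>j\<in>{1..n}. if j = i then (f i)\<^sup>2 * (\<integral>x. \<phi> i x * \<phi> i x \<partial>M) else 0)"
      using i orthogonal by (intro sum.cong refl) (auto simp: power2_eq_square)
    then show "(\<Sum>j\<in>{1..n}. f i * f j * (\<integral>x. \<phi> i x * \<phi> j x \<partial>M)) = (f i)\<^sup>2 * (\<integral>x. \<phi> i x * \<phi> i x \<partial>M)"
      using i by simp
  qed
  also have "\<dots> \<le> (\<Sum>i\<in>{1..n}. (f i)\<^sup>2 * 1)"
  proof (intro sum_mono mult_left_mono)
    fix i assume i: "i \<in> {1..n}"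
    have "\<phi> i x * \<phi> i x \<le> 1" for x
      using abs_phi_le[OF i, of x] by (simp add: abs_square_le_1 flip: power2_eq_square)
    then show "(\<integral>x. \<phi> i x * \<phi> i x \<partial>M) \<le> 1"
      using int2[OF i i] by (intro integral_le_const) auto
  qed auto
  finally have GG: "(\<integral>x. (G x)\<^sup>2 \<partial>M) \<le> ?q" by simp
  have "(\<integral>x. indicator E x * G x \<partial>M) = (\<Sum>i\<in>{1..n}. f i * (\<integral>x. indicator E x * \<phi> i x \<partial>M))"
  proof -
    have "(\<integral>x. indicator E x * G x \<partial>M) = (\<Sum>i\<in>{1..n}. \<integral>x. f i * (indicator E x * \<phi> i x) \<partial>M)"
      unfolding EG using intE by (intro Bochner_Integration.integral_sum integrable_mult_right)
    then show ?thesis by simp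
  qed
  also have "\<dots> = prob E * ?q"
    using E by (simp add: f_def cond_coeff_def sum_distrib_left power2_eq_square)
  finally have EGi: "(\<integral>x. indicator E x * G x \<partial>M) = prob E * ?q" .
  have "0 \<le> (\<integral>x. (indicator E x / prob E - G x)\<^sup>2 \<partial>M)" by simp
  also have "\<dots> = (\<integral>x. (1 / (prob E)\<^sup>2) * indicator E x - (2 / prob E) * (indicator E x * G x) + (G x)\<^sup>2 \<partial>M)"
    by (intro Bochner_Integration.integral_cong refl)
       (auto simp: power2_eq_square indicator_def algebra_simps)
  also have "\<dots> = (1 / (prob E)\<^sup>2) * prob E - (2 / prob E) * (prob E * ?q) + (\<integral>x. (G x)\<^sup>2 \<partial>M)"
    using intI intEG intG2 E EGi by simp
  also have "\<dots> = 1 / prob E - 2 * ?q + (\<integral>x. (G x)\<^sup>2 \<partial>M)"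
    using E by (simp add: power2_eq_square)
  finally show ?thesis using GG by (simp add: f_def)
qed

end

section \<open>Energy of the coefficients on a random subset\<close>

text \<open>A layer-cake decomposition of \<open>x\<^sup>2\<close> with thresholds \<open>3 * 2\<^sup>-\<^sup>l\<close>. The factor \<open>3\<close> leaves room for an
error \<open>2\<^sup>-\<^sup>l\<close> on either side of the threshold \<open>2 * 2\<^sup>-\<^sup>l\<close> for the approximate coefficients.\<close>

lemma square_le_level_sum:
  fixes x :: real
  assumes "\<bar>x\<bar> \<le> 1"
  shows "x\<^sup>2 \<le> 36 * (1 / 4) ^ N + 36 * (\<Sum>l<N. (1 / 4) ^ l * of_bool (3 * (1 / 2) ^ l \<le> \<bar>x\<bar>))"
proof (induction N)
  case 0
  have "x\<^sup>2 \<le> 1" using assms by (simp add: abs_square_le_1)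
  then show ?case by simp
next
  case (Suc N)
  let ?s = "\<Sum>l<N. (1 / 4) ^ l * of_bool (3 * (1 / 2) ^ l \<le> \<bar>x\<bar>) :: real"
  have s: "0 \<le> ?s" by (intro sum_nonneg) auto
  show ?case
  proof (cases "3 * (1 / 2) ^ N \<le> \<bar>x\<bar>")
    case True
    then show ?thesis using Suc s by (simp add: field_simps)
  next
    case False
    then have "\<bar>x\<bar> ^ 2 \<le> (3 * (1 / 2) ^ N)\<^sup>2" by (intro power_mono) auto
    also have "\<dots> = 9 * ((1 / 2) ^ N * (1 / 2) ^ N)" by (simp add: power2_eq_square)
    also have "\<dots> = 36 * (1 / 4) ^ Suc N" by (simp flip: power_mult_distrib)
    finally have "x\<^sup>2 \<le> 36 * (1 / 4) ^ Suc N" by simp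
    then show ?thesis using s False by simp
  qed
qed

lemma level_sum_le_square:
  fixes x :: real
  shows "(\<Sum>l<N. (1 / 4) ^ l * of_bool ((1 / 2) ^ l \<le> \<bar>x\<bar>)) \<le> 4 / 3 * x\<^sup>2"
proof -
  have "(\<Sum>l<N. (1 / 4) ^ l * of_bool ((1 / 2) ^ l \<le> \<bar>x\<bar>)) \<le> max 0 (4 / 3 * (x\<^sup>2 - (1 / 4) ^ N))"
  proof (induction N)
    case (Suc N)
    have pos: "0 < (1 / 4 :: real) ^ N" by simp
    show ?case
    proof (cases "(1 / 2) ^ N \<le> \<bar>x\<bar>")
      case True
      then have "((1 / 2) ^ N)\<^sup>2 \<le> \<bar>x\<bar>\<^sup>2" by (intro power_mono) auto
      also have "((1 / 2 :: real) ^ N)\<^sup>2 = (1 / 4) ^ N"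
        by (simp only: power2_eq_square flip: power_mult_distrib) simp
      finally have "(1 / 4) ^ N \<le> x\<^sup>2" by simp
      then have "(\<Sum>l<N. (1 / 4) ^ l * of_bool ((1 / 2) ^ l \<le> \<bar>x\<bar>)) \<le> 4 / 3 * (x\<^sup>2 - (1 / 4) ^ N)"
        using Suc by (simp add: max_absorb2)
      moreover have "s \<le> 4 / 3 * (x\<^sup>2 - d) \<Longrightarrow> s + d \<le> 4 / 3 * (x\<^sup>2 - 1 / 4 * d)" for s d
        by (simp add: field_simps)
      ultimately have "(\<Sum>l<N. (1 / 4) ^ l * of_bool ((1 / 2) ^ l \<le> \<bar>x\<bar>)) + (1 / 4) ^ N
          \<le> 4 / 3 * (x\<^sup>2 - 1 / 4 * (1 / 4) ^ N)"
        by blast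
      then show ?thesis using True by (simp add: max.coboundedI2)
    next
      case False
      have le: "max 0 (4 / 3 * (x\<^sup>2 - (1 / 4) ^ N)) \<le> max 0 (4 / 3 * (x\<^sup>2 - (1 / 4) ^ Suc N))"
        using pos by (intro max.mono mult_left_mono diff_mono) auto
      have eq: "(\<Sum>l<Suc N. (1 / 4) ^ l * of_bool ((1 / 2) ^ l \<le> \<bar>x\<bar>))
          = (\<Sum>l<N. (1 / 4 :: real) ^ l * of_bool ((1 / 2) ^ l \<le> \<bar>x\<bar>))"
        using False by simp
      show ?thesis unfolding eq by (rule order_trans[OF Suc le])
    qed
  qed simp
  also have "\<dots> \<le> 4 / 3 * x\<^sup>2"
    by (simp add: max_def)
  finally show ?thesis .
qed

context bounded_orthogonal_family
begin

definition heavy :: "nat \<Rightarrow> (real \<times> nat) list \<Rightarrow> nat set" where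
  "heavy l w = {i \<in> {1..n}. 2 * (1 / 2) ^ l \<le> \<bar>tilt_coeff w i\<bar>}"

lemma heavy_subset: "heavy l w \<subseteq> {1..n}"
  by (auto simp: heavy_def)

lemma letters_finite_card: "finite (letters k)" "card (letters k) \<le> 2 * (k + 1) * n"
proof -
  let ?C = "(\<lambda>l. (1 / 2 :: real) ^ Suc l) ` {..k} \<union> (\<lambda>l. - ((1 / 2 :: real) ^ Suc l)) ` {..k}"
  have sub: "letters k \<subseteq> ?C \<times> {1..n}"
    unfolding letters_def
  proof (intro Sigma_mono subsetI order_refl)
    fix c :: real
    assume "c \<in> {c. \<exists>j\<le>k. \<bar>c\<bar> = (1 / 2) ^ Suc j}"
    then obtain j where j: "j \<le> k" "\<bar>c\<bar> = (1 / 2) ^ Suc j" by blast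
    then have "c = (1 / 2) ^ Suc j \<or> c = - ((1 / 2) ^ Suc j)" by linarith
    then show "c \<in> ?C" using j(1) by blast
  qed
  then show "finite (letters k)" by (rule finite_subset) simp
  have "card ?C \<le> card {..k} + card {..k}"
    by (intro order_trans[OF card_Un_le] add_mono card_image_le finite_atMost)
  then have "card ?C * n \<le> 2 * (k + 1) * n"
    by (intro mult_right_mono) auto
  moreover have "card (letters k) \<le> card (?C \<times> {1..n})"
    using sub by (intro card_mono) auto
  ultimately show "card (letters k) \<le> 2 * (k + 1) * n"
    by (simp add: card_cartesian_product)
qed

text \<open>Since the coefficients of \<open>E\<close> and of the tilt \<open>W l\<close> differ by at most \<open>2\<^sup>-\<^sup>l\<close>, the set \<open>heavy l (W l)\<close> lies
between \<open>{i. \<bar>cond_coeff E i\<bar> \<ge> 3 * 2\<^sup>-\<^sup>l}\<close> and \<open>{i. \<bar>cond_coeff E i\<bar> \<ge> 2\<^sup>-\<^sup>l}\<close>. The first inclusion bounds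
the sum over \<open>S\<close> by the numbers \<open>card (S \<inter> heavy l (W l))\<close>. The second one turns the terms with
\<open>\<alpha>\<close> back into the sum of the squares over all of \<open>{1..n}\<close>, to which Bessel's inequality applies.\<close>

lemma sum_cond_coeff_squared_subset_le:
  fixes \<alpha> \<gamma> :: real
  assumes E: "E \<in> events" "0 < prob E" and S: "S \<subseteq> {1..n}"
    and \<alpha>: "0 \<le> \<alpha>" and \<gamma>: "0 \<le> \<gamma>"
    and sparse: "\<And>l w. l < n \<Longrightarrow> w \<in> lists (letters (n - 1)) \<Longrightarrow>
        real (card (S \<inter> heavy l w)) \<le> \<alpha> * card (heavy l w) + \<gamma> * (length w + 1)"
  shows "(\<Sum>i\<in>S. (cond_coeff E i)\<^sup>2)
         \<le> 36 + 48 * \<alpha> * (1 / prob E) + 192 * \<gamma> * (1 + ln (1 / prob E))"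
proof -
  let ?f = "cond_coeff E"
  have finS: "finite S" using S finite_subset by blast
  obtain W where W: "\<And>l. W l \<in> lists (letters l)"
    "\<And>l i. i \<in> {1..n} \<Longrightarrow> \<bar>?f i - tilt_coeff (W l) i\<bar> \<le> (1 / 2) ^ l"
    "\<And>k. (\<Sum>l<k. (1 / 4) ^ l * length (W l)) \<le> 16 / 3 * ln (1 / prob E)"
    using exists_multiscale_words[OF E] by blast
  have low: "i \<in> heavy l (W l)" if "i \<in> {1..n}" "3 * (1 / 2) ^ l \<le> \<bar>?f i\<bar>" for i l
    using that W(2)[of i l] by (simp add: heavy_def)
  have high: "(1 / 2) ^ l \<le> \<bar>?f i\<bar>" if "i \<in> heavy l (W l)" for i l
  proof -
    have "i \<in> {1..n}" "2 * (1 / 2) ^ l \<le> \<bar>tilt_coeff (W l) i\<bar>"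
      using that by (auto simp: heavy_def)
    then show ?thesis using W(2)[of i l] by linarith
  qed
  have tail: "(\<Sum>i\<in>S. 36 * (1 / 4) ^ n) \<le> (36 :: real)"
  proof -
    have "card S \<le> card {1..n}" using S by (intro card_mono) auto
    then have "real (card S) \<le> real n" by simp
    also have "real n \<le> 4 ^ n"
    proof -
      have "n < 2 ^ n" by (rule less_exp)
      then have "real n \<le> 2 ^ n" by (metis less_imp_le of_nat_le_iff of_nat_numeral of_nat_power)
      also have "\<dots> \<le> 4 ^ n" by (intro power_mono) auto
      finally show ?thesis .
    qed
    finally show ?thesis by (simp add: power_divide field_simps)
  qed
  have count_low: "(\<Sum>i\<in>S. of_bool (3 * (1 / 2) ^ l \<le> \<bar>?f i\<bar>)) \<le> real (card (S \<inter> heavy l (W l)))" for l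
  proof -
    have "(\<Sum>i\<in>S. of_bool (3 * (1 / 2) ^ l \<le> \<bar>?f i\<bar>)) \<le> (\<Sum>i\<in>S. of_bool (i \<in> heavy l (W l)) :: real)"
      using low S by (intro sum_mono) (auto simp: of_bool_def)
    also have "\<dots> = real (card (S \<inter> heavy l (W l)))"
      using finS by (simp add: of_bool_def sum.If_cases Int_def)
    finally show ?thesis .
  qed
  have count_high: "real (card (heavy l (W l))) \<le> (\<Sum>i\<in>{1..n}. of_bool ((1 / 2) ^ l \<le> \<bar>?f i\<bar>))" for l
  proof -
    have "real (card (heavy l (W l))) = (\<Sum>i\<in>{1..n}. of_bool (i \<in> heavy l (W l)))"
      using heavy_subset[of l "W l"]
      by (simp add: of_bool_def sum.If_cases Int_absorb1 Int_commute)
    also have "\<dots> \<le> (\<Sum>i\<in>{1..n}. of_bool ((1 / 2) ^ l \<le> \<bar>?f i\<bar>))"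
      using high by (intro sum_mono) (auto simp: of_bool_def)
    finally show ?thesis .
  qed
  have geo: "(\<Sum>l<n. (1 / 4) ^ l) \<le> (4 / 3 :: real)"
    using zero_le_power[of "1 / 4 :: real" n] by (simp add: sum_gp_strict)
  have "(\<Sum>i\<in>S. (?f i)\<^sup>2)
      \<le> (\<Sum>i\<in>S. 36 * (1 / 4) ^ n + 36 * (\<Sum>l<n. (1 / 4) ^ l * of_bool (3 * (1 / 2) ^ l \<le> \<bar>?f i\<bar>)))"
    using S abs_cond_coeff_le[OF E] by (intro sum_mono square_le_level_sum) auto
  also have "\<dots> = (\<Sum>i\<in>S. 36 * (1 / 4) ^ n)
      + 36 * (\<Sum>l<n. (1 / 4) ^ l * (\<Sum>i\<in>S. of_bool (3 * (1 / 2) ^ l \<le> \<bar>?f i\<bar>)))"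
    by (simp only: sum.distrib sum_distrib_left sum.swap[of _ "{..<n}" S])
  also have "\<dots> \<le> 36 + 36 * (\<Sum>l<n. (1 / 4) ^ l * real (card (S \<inter> heavy l (W l))))"
    using count_low by (intro add_mono tail mult_left_mono sum_mono) auto
  also have "(\<Sum>l<n. (1 / 4) ^ l * real (card (S \<inter> heavy l (W l))))
      \<le> (\<Sum>l<n. (1 / 4) ^ l * (\<alpha> * (\<Sum>i\<in>{1..n}. of_bool ((1 / 2) ^ l \<le> \<bar>?f i\<bar>)) + \<gamma> * (length (W l) + 1)))"
  proof (intro sum_mono mult_left_mono)
    fix l assume l: "l \<in> {..<n}"
    then have "W l \<in> lists (letters (n - 1))"
      using W(1)[of l] letters_mono[of l "n - 1"] lists_mono by fastforce
    then have "real (card (S \<inter> heavy l (W l))) \<le> \<alpha> * card (heavy l (W l)) + \<gamma> * (length (W l) + 1)"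
      using l by (intro sparse) auto
    also have "\<dots> \<le> \<alpha> * (\<Sum>i\<in>{1..n}. of_bool ((1 / 2) ^ l \<le> \<bar>?f i\<bar>)) + \<gamma> * (length (W l) + 1)"
      by (intro add_mono mult_left_mono count_high \<alpha> order_refl)
    finally show "real (card (S \<inter> heavy l (W l)))
      \<le> \<alpha> * (\<Sum>i\<in>{1..n}. of_bool ((1 / 2) ^ l \<le> \<bar>?f i\<bar>)) + \<gamma> * (length (W l) + 1)" .
  qed auto
  also have "\<dots> = \<alpha> * (\<Sum>i\<in>{1..n}. \<Sum>l<n. (1 / 4) ^ l * of_bool ((1 / 2) ^ l \<le> \<bar>?f i\<bar>))
      + \<gamma> * ((\<Sum>l<n. (1 / 4) ^ l * length (W l)) + (\<Sum>l<n. (1 / 4) ^ l))"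
    unfolding sum.swap[of _ "{..<n}" "{1..n}"]
    by (simp add: sum.distrib sum_distrib_left algebra_simps)
  also have "\<dots> \<le> \<alpha> * (4 / 3 * (1 / prob E)) + \<gamma> * (16 / 3 * ln (1 / prob E) + 4 / 3)"
  proof (intro add_mono mult_left_mono W(3) geo \<alpha> \<gamma>)
    have "(\<Sum>i\<in>{1..n}. \<Sum>l<n. (1 / 4) ^ l * of_bool ((1 / 2) ^ l \<le> \<bar>?f i\<bar>)) \<le> (\<Sum>i\<in>{1..n}. 4 / 3 * (?f i)\<^sup>2)"
      by (intro sum_mono level_sum_le_square)
    also have "\<dots> \<le> 4 / 3 * (1 / prob E)"
      unfolding sum_distrib_left[symmetric]
      by (intro mult_left_mono sum_cond_coeff_squared_le E) simp
    finally show "(\<Sum>i\<in>{1..n}. \<Sum>l<n. (1 / 4) ^ l * of_bool ((1 / 2) ^ l \<le> \<bar>?f i\<bar>)) \<le> 4 / 3 * (1 / prob E)" .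
  qed
  also have "36 + 36 * (\<alpha> * (4 / 3 * (1 / prob E)) + \<gamma> * (16 / 3 * ln (1 / prob E) + 4 / 3))
      \<le> 36 + 48 * \<alpha> * (1 / prob E) + 192 * \<gamma> * (1 + ln (1 / prob E))"
    using \<gamma> by (simp add: algebra_simps)
  finally show ?thesis by simp
qed

text \<open>If \<open>1 / prob E \<le> n\<^sup>\<epsilon>\<close>, the choice \<open>\<beta> = \<epsilon> ln n\<close> applies: the loss \<open>n\<^sup>\<epsilon>\<close> in the density term is harmless,
as \<open>m / n \<le> n\<^sup>-\<^sup>2\<^sup>\<epsilon>\<close>, and no factor \<open>ln n\<close> appears. Otherwise \<open>ln n \<le> ln (1 / prob E) / \<epsilon>\<close>, so the factor
\<open>ln n\<close> that comes with \<open>\<beta> = 1\<close> is absorbed by a second factor \<open>ln (1 / prob E)\<close>.\<close>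

lemma exists_subset_small_energy:
  assumes n: "2 \<le> n" and \<epsilon>: "0 < \<epsilon>" "\<epsilon> \<le> 1" and m: "real m \<le> real n powr (1 - 2 * \<epsilon>)"
  shows "\<exists>S\<subseteq>{1..n}. card S = m \<and> (\<forall>E\<in>events. 0 < prob E \<longrightarrow>
           (\<Sum>i\<in>S. (cond_coeff E i)\<^sup>2)
           \<le> 432 * (m / n) * (1 / prob E) + 1500 / \<epsilon> * (1 + ln (1 / prob E))\<^sup>2)"
proof -
  have n0: "0 < real n" "1 \<le> real n" using n by auto
  have lnpos: "0 < ln (real n)" using n by simp
  have "real m \<le> real n powr 1"
    using m n0 \<epsilon> by (intro order_trans[OF m] powr_mono) auto
  then have mn: "m \<le> n" using n0 by simp
  have dens: "real m / real n \<le> real n powr (- 2 * \<epsilon>)"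
    using m n0 by (simp add: divide_le_eq powr_diff powr_minus divide_simps split: if_splits)
  have card: "card (letters (n - 1)) \<le> n ^ 3"
  proof -
    have "2 * (n - 1 + 1) * n \<le> n ^ 3"
      using n by (simp add: power3_eq_cube)
    then show ?thesis using letters_finite_card(2)[of "n - 1"] by linarith
  qed
  obtain S where S: "S \<subseteq> {1..n}" "card S = m"
    and sparse: "\<And>\<beta> l w. \<beta> \<in> {1, \<epsilon> * ln n} \<Longrightarrow> l < n \<Longrightarrow> w \<in> lists (letters (n - 1)) \<Longrightarrow>
        real (card (S \<inter> heavy l w)) \<le> exp (1 + \<beta>) * (m / n) * card (heavy l w) + 6 * (length w + 1) * ln n / \<beta>"
  proof -
    have B: "finite {1, \<epsilon> * ln n}" "card {1, \<epsilon> * ln n} \<le> 2" "\<And>\<beta>. \<beta> \<in> {1, \<epsilon> * ln n} \<Longrightarrow> 0 < \<beta>"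
      using \<epsilon> lnpos by (auto simp: card_insert_if)
    have "\<exists>S\<subseteq>{1..n}. card S = m \<and> (\<forall>\<beta>\<in>{1, \<epsilon> * ln n}. \<forall>l<n.
        \<forall>w\<in>lists (letters (n - 1)). real (card (S \<inter> heavy l w))
          \<le> exp (1 + \<beta>) * (m / n) * card (heavy l w) + 6 * (length w + 1) * ln n / \<beta>)"
      by (intro exists_uniformly_sparse_subset n mn letters_finite_card(1) card B heavy_subset)
    then obtain S where S: "S \<subseteq> {1..n}" "card S = m" and sparse: "\<forall>\<beta>\<in>{1, \<epsilon> * ln n}. \<forall>l<n.
        \<forall>w\<in>lists (letters (n - 1)). real (card (S \<inter> heavy l w))
          \<le> exp (1 + \<beta>) * (m / n) * card (heavy l w) + 6 * (length w + 1) * ln n / \<beta>"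
      by (elim exE conjE)
    show thesis
      by (rule that[OF S]) (rule sparse[rule_format])
  qed
  have e1: "exp 1 \<le> (3 :: real)" by (rule exp_le)
  have e2: "exp 2 \<le> (9 :: real)"
    using mult_mono[OF e1 e1] by (simp flip: exp_add)
  have energy: "(\<Sum>i\<in>S. (cond_coeff E i)\<^sup>2)
      \<le> 36 + 48 * (exp (1 + \<beta>) * (m / n)) * (1 / prob E) + 192 * (6 * ln n / \<beta>) * (1 + ln (1 / prob E))"
    if "\<beta> \<in> {1, \<epsilon> * ln n}" "E \<in> events" "0 < prob E" for \<beta> E
  proof (intro sum_cond_coeff_squared_subset_le that S(1))
    show "0 \<le> 6 * ln n / \<beta>" using that(1) \<epsilon> lnpos by auto
    show "real (card (S \<inter> heavy l w)) \<le> exp (1 + \<beta>) * (m / n) * card (heavy l w) + 6 * ln n / \<beta> * (length w + 1)"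
      if "l < n" "w \<in> lists (letters (n - 1))" for l w
      using sparse[OF \<open>\<beta> \<in> {1, \<epsilon> * ln n}\<close> that] by (simp add: field_simps)
  qed simp
  have "(\<Sum>i\<in>S. (cond_coeff E i)\<^sup>2)
      \<le> 432 * (m / n) * (1 / prob E) + 1500 / \<epsilon> * (1 + ln (1 / prob E))\<^sup>2"
    if E: "E \<in> events" "0 < prob E" for E
  proof -
    define L where "L = ln (1 / prob E)"
    have L: "0 \<le> L" using E by (simp add: L_def)
    have L2: "1 + L \<le> (1 + L)\<^sup>2" "1 \<le> (1 + L)\<^sup>2"
      using L by (auto simp: power2_eq_square algebra_simps)
    have A: "0 \<le> (m / n) * (1 / prob E)" using E by simp
    have A': "0 \<le> 432 * (m / n) * (1 / prob E)" using E by simp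
    have \<epsilon>1: "1 \<le> 1 / \<epsilon>" using \<epsilon> by simp
    have one_le: "1 \<le> 1 / \<epsilon> * (1 + L)\<^sup>2"
      using mult_mono[OF \<epsilon>1 L2(2)] \<epsilon> by simp
    show ?thesis
    proof (cases "1 / prob E \<le> real n powr \<epsilon>")
      case True
      have "exp (\<epsilon> * ln n) * (m / n) * (1 / prob E) \<le> real n powr \<epsilon> * real n powr (- 2 * \<epsilon>) * real n powr \<epsilon>"
        using True dens E n0 by (intro mult_mono) (auto simp: powr_def)
      also have "\<dots> = 1" using n0 by (simp flip: powr_add)
      finally have "48 * (exp 1 * (exp (\<epsilon> * ln n) * (m / n) * (1 / prob E))) \<le> 48 * (3 * 1)"
        using e1 E by (intro mult_left_mono mult_mono) auto
      then have "48 * (exp (1 + \<epsilon> * ln n) * (m / n)) * (1 / prob E) \<le> 144"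
        by (simp add: exp_add ac_simps)
      moreover have "192 * (6 * ln n / (\<epsilon> * ln n)) * (1 + ln (1 / prob E)) = 1152 * (1 / \<epsilon> * (1 + L))"
        using lnpos by (simp add: L_def)
      ultimately have "(\<Sum>i\<in>S. (cond_coeff E i)\<^sup>2) \<le> 180 + 1152 * (1 / \<epsilon> * (1 + L))"
        using energy[of "\<epsilon> * ln n" E] E by simp
      also have "\<dots> \<le> 180 * (1 / \<epsilon> * (1 + L)\<^sup>2) + 1152 * (1 / \<epsilon> * (1 + L)\<^sup>2)"
      proof (intro add_mono)
        show "180 \<le> 180 * (1 / \<epsilon> * (1 + L)\<^sup>2)"
          using one_le by linarith
        show "1152 * (1 / \<epsilon> * (1 + L)) \<le> 1152 * (1 / \<epsilon> * (1 + L)\<^sup>2)"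
          using L2(1) \<epsilon> by (intro mult_left_mono) simp_all
      qed
      also have "\<dots> \<le> 1500 / \<epsilon> * (1 + L)\<^sup>2"
        using \<epsilon> by (simp add: field_simps)
      finally show ?thesis using A' unfolding L_def by linarith
    next
      case False
      then have "ln (real n powr \<epsilon>) \<le> L"
        unfolding L_def using n0 E by (subst ln_le_cancel_iff) auto
      then have lnn: "ln n \<le> 1 / \<epsilon> * L"
        using \<epsilon> n0 by (simp add: ln_powr field_simps)
      have "(\<Sum>i\<in>S. (cond_coeff E i)\<^sup>2)
          \<le> 36 + 48 * exp 2 * ((m / n) * (1 / prob E)) + 1152 * (ln n * (1 + L))"
        using energy[of 1 E] E by (simp add: L_def)
      also have "\<dots> \<le> 36 * (1 / \<epsilon> * (1 + L)\<^sup>2) + 48 * 9 * ((m / n) * (1 / prob E)) + 1152 * (1 / \<epsilon> * (1 + L)\<^sup>2)"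
      proof (intro add_mono mult_left_mono mult_right_mono A e2)
        show "36 \<le> 36 * (1 / \<epsilon> * (1 + L)\<^sup>2)"
          using one_le by linarith
        have "ln n * (1 + L) \<le> (1 / \<epsilon> * (1 + L)) * (1 + L)"
          using lnn L \<epsilon> by (intro mult_right_mono) (auto simp: field_simps)
        then show "ln n * (1 + L) \<le> 1 / \<epsilon> * (1 + L)\<^sup>2"
          by (simp add: power2_eq_square)
      qed auto
      also have "\<dots> \<le> 432 * (m / n) * (1 / prob E) + 1500 / \<epsilon> * (1 + L)\<^sup>2"
        using \<epsilon> by (simp add: field_simps)
      finally show ?thesis by (simp add: L_def)
    qed
  qed
  then show ?thesis using S by blast
qed

end

section \<open>From tail bounds to moments\<close>

text \<open>Solves the inequality for \<open>u\<close>. The square of the logarithm is dominated by a small power of \<open>1 / u\<close>,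
which gives a tail \<open>T\<^sup>-\<^sup>q\<close> for every \<open>q\<close>; any \<open>q > p\<close> suffices for a bounded \<open>p\<close>-th moment.\<close>

lemma level_inversion:
  fixes A B T u q :: real
  assumes T: "0 < T" and u: "0 < u" "u \<le> 1" and q: "1 \<le> q" and A: "0 \<le> A" and B: "0 < B"
    and le: "T\<^sup>2 \<le> A * (1 / u) + B * (1 + ln (1 / u))\<^sup>2"
  shows "u \<le> 2 * A / T\<^sup>2 + (2 * B * q\<^sup>2) powr (q / 2) * T powr (- q)"
proof (cases "T\<^sup>2 \<le> 2 * (A * (1 / u))")
  case True
  then have "u \<le> 2 * A / T\<^sup>2"
    using T u by (simp add: field_simps)
  moreover have "0 \<le> (2 * B * q\<^sup>2) powr (q / 2) * T powr (- q)" by simp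
  ultimately show ?thesis by linarith
next
  case False
  define v where "v = u powr (- 1 / q)"
  have v: "0 < v" using u by (simp add: v_def)
  have "ln (1 / u) = q * ln v"
    using u q by (simp add: v_def ln_powr ln_div)
  also have "\<dots> \<le> q * (v - 1)"
    using q v by (intro mult_left_mono ln_le_minus_one) auto
  finally have "1 + ln (1 / u) \<le> q * v"
    using q by (simp add: algebra_simps)
  moreover have "0 \<le> ln (1 / u)" using u by simp
  ultimately have "(1 + ln (1 / u))\<^sup>2 \<le> (q * v)\<^sup>2"
    by (intro power_mono) auto
  then have "B * (1 + ln (1 / u))\<^sup>2 \<le> B * (q * v)\<^sup>2"
    using B by (intro mult_left_mono) auto
  then have "T\<^sup>2 \<le> 2 * (B * (q * v)\<^sup>2)"
    using False le by linarith
  also have "\<dots> = 2 * B * q\<^sup>2 * v\<^sup>2"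
    by (simp add: power_mult_distrib)
  finally have "(T\<^sup>2) powr (q / 2) \<le> (2 * B * q\<^sup>2 * v\<^sup>2) powr (q / 2)"
    using q by (intro powr_mono2) auto
  also have "\<dots> = (2 * B * q\<^sup>2) powr (q / 2) * (v\<^sup>2) powr (q / 2)"
    using B by (simp add: powr_mult)
  also have "(v\<^sup>2) powr (q / 2) = 1 / u"
  proof -
    have "(v\<^sup>2) powr (q / 2) = (v powr 2) powr (q / 2)" using v by simp
    also have "\<dots> = u powr (- 1)"
    proof -
      have "- 1 / q * 2 * (q / 2) = - 1" using q by simp
      then show ?thesis by (simp only: v_def powr_powr)
    qed
    finally show ?thesis using u by (simp only: powr_neg_one)
  qed
  also have "(T\<^sup>2) powr (q / 2) = T powr q"
  proof -
    have "(T\<^sup>2) powr (q / 2) = (T powr 2) powr (q / 2)" using T by simp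
    then show ?thesis by (simp add: powr_powr)
  qed
  finally have "u * T powr q \<le> (2 * B * q\<^sup>2) powr (q / 2)"
    using u by (simp add: field_simps)
  then have "u \<le> (2 * B * q\<^sup>2) powr (q / 2) * T powr (- q)"
    using T by (simp add: powr_minus field_simps)
  moreover have "0 \<le> 2 * A / T\<^sup>2" using A by simp
  ultimately show ?thesis by linarith
qed

lemma powr_le_dyadic_sum:
  fixes y p :: real
  assumes p: "0 \<le> p" and y: "0 \<le> y" "y < 2 ^ J"
  shows "y powr p \<le> 1 + (\<Sum>j<J. (2 ^ Suc j) powr p * of_bool (2 ^ j \<le> y))"
  using y
proof (induction J)
  case 0
  then have "y powr p \<le> 1 powr p" using p by (intro powr_mono2) auto
  then show ?case by simp
next
  case (Suc J)
  let ?g = "\<lambda>j. (2 ^ Suc j) powr p * of_bool (2 ^ j \<le> y) :: real"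
  have g: "0 \<le> (\<Sum>j<J. ?g j)" by (intro sum_nonneg) auto
  show ?case
  proof (cases "y < 2 ^ J")
    case True
    then have "y powr p \<le> 1 + (\<Sum>j<J. ?g j)" using Suc by simp
    also have "\<dots> \<le> 1 + (\<Sum>j<Suc J. ?g j)" by simp
    finally show ?thesis .
  next
    case False
    have "y powr p \<le> (2 ^ Suc J) powr p"
      using Suc p by (intro powr_mono2) auto
    also have "\<dots> = ?g J" using False by simp
    also have "\<dots> \<le> 1 + (\<Sum>j<Suc J. ?g j)" using g by simp
    finally show ?thesis .
  qed
qed

text \<open>The term \<open>A / T\<^sup>2\<close> contributes \<open>A T\<^sup>p\<^sup>-\<^sup>2\<close> at level \<open>T\<close>. As \<open>p > 2\<close>, this is a geometric sum
dominated by the largest level \<open>b\<close>; the other term is dominated by the lowest level.\<close>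

lemma dyadic_moment_sum_le:
  fixes p A K b :: real
  assumes p: "2 < p" and A: "0 \<le> A" and K: "0 \<le> K" and J: "0 < J" "2 ^ (J - 1) \<le> b"
  shows "(\<Sum>j<J. (2 ^ Suc j) powr p * (A / (2 ^ j)\<^sup>2 + K * (2 ^ j) powr (- (p + 1))))
         \<le> 2 powr p * (2 powr (p - 2) / (2 powr (p - 2) - 1)) * (A * b powr (p - 2)) + 2 powr p * (2 * K)"
proof -
  define r :: real where "r = 2 powr (p - 2)"
  have r: "1 < r" using p by (simp add: r_def)
  have pw: "(2 ^ j) powr s = (2 powr s) ^ j" for j :: nat and s :: real
    by (simp add: powr_realpow[symmetric] powr_powr mult.commute)
  have summand: "(2 ^ Suc j) powr p * (A / (2 ^ j)\<^sup>2 + K * (2 ^ j) powr (- (p + 1)))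
      = 2 powr p * (A * r ^ j + K * (1 / 2) ^ j)" for j
  proof -
    have "(2 ^ Suc j) powr p = 2 powr p * (2 ^ j) powr p"
      by (simp add: powr_mult)
    moreover have "(2 ^ j) powr p / (2 ^ j)\<^sup>2 = r ^ j"
    proof -
      have "r ^ j = (2 ^ j) powr (p - 2)" by (simp add: r_def pw)
      also have "\<dots> = (2 ^ j) powr p / (2 ^ j) powr 2" by (simp add: powr_diff)
      finally show ?thesis by simp
    qed
    moreover have "(2 ^ j) powr p * (2 ^ j) powr (- (p + 1)) = (1 / 2 :: real) ^ j"
    proof -
      have "(2 ^ j) powr p * (2 ^ j) powr (- (p + 1)) = (2 ^ j :: real) powr (- 1)"
        by (simp flip: powr_add)
      also have "\<dots> = 1 / 2 ^ j" by (rule powr_neg_one) simp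
      also have "\<dots> = (1 / 2) ^ j" by (simp add: power_one_over)
      finally show ?thesis .
    qed
    ultimately show ?thesis
      by (simp add: distrib_left mult.assoc mult.left_commute[of _ K] mult.left_commute[of _ A]
          flip: times_divide_eq_right) (simp add: mult.assoc flip: times_divide_eq_left)
  qed
  have "(\<Sum>j<J. r ^ j) = (r ^ J - 1) / (r - 1)"
    using r by (simp add: sum_gp_strict field_simps)
  also have "\<dots> \<le> r ^ J / (r - 1)"
    using r by (intro divide_right_mono) auto
  also have "r ^ J = r * (2 ^ (J - 1)) powr (p - 2)"
    using J(1) by (cases J) (auto simp: r_def pw)
  also have "r * (2 ^ (J - 1)) powr (p - 2) / (r - 1) \<le> r * b powr (p - 2) / (r - 1)"
    using r p J by (intro divide_right_mono mult_left_mono powr_mono2) auto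
  finally have 1: "(\<Sum>j<J. r ^ j) \<le> r / (r - 1) * b powr (p - 2)" by simp
  have 2: "(\<Sum>j<J. (1 / 2 :: real) ^ j) \<le> 2"
    by (simp add: sum_gp_strict)
  have "(\<Sum>j<J. (2 ^ Suc j) powr p * (A / (2 ^ j)\<^sup>2 + K * (2 ^ j) powr (- (p + 1))))
      = 2 powr p * (A * (\<Sum>j<J. r ^ j)) + 2 powr p * (K * (\<Sum>j<J. (1 / 2) ^ j))"
    unfolding summand by (simp add: sum.distrib sum_distrib_left algebra_simps)
  also have "\<dots> \<le> 2 powr p * (A * (r / (r - 1) * b powr (p - 2))) + 2 powr p * (K * 2)"
    using A K 1 2 by (intro add_mono mult_left_mono) auto
  finally show ?thesis by (simp add: r_def ac_simps)
qed

context bounded_orthogonal_family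
begin

lemma borel_measurable_sum_phi:
  assumes "S \<subseteq> {1..n}"
  shows "(\<lambda>x. \<Sum>i\<in>S. a i * \<phi> i x) \<in> borel_measurable M"
  using assms measurable_phi by (intro borel_measurable_sum borel_measurable_times borel_measurable_const) auto

text \<open>Duality: the mean of \<open>\<Sum>i\<in>S. a i * \<phi> i\<close> over its own superlevel set is at least \<open>T\<close>, and it equals
\<open>\<Sum>i\<in>S. a i * cond_coeff E i\<close>.\<close>

lemma superlevel_square_le:
  assumes S: "S \<subseteq> {1..n}" and a: "(\<Sum>i\<in>S. (a i)\<^sup>2) \<le> 1" and T: "0 < T"
    and E: "E = {x \<in> space M. T \<le> (\<Sum>i\<in>S. a i * \<phi> i x)}" and u: "0 < prob E"
  shows "T\<^sup>2 \<le> (\<Sum>i\<in>S. (cond_coeff E i)\<^sup>2)"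
proof -
  have Eev: "E \<in> events"
    unfolding E using borel_measurable_sum_phi[OF S, of a] by measurable
  have intE: "integrable M (\<lambda>x. indicator E x * \<phi> i x)" if "i \<in> S" for i
  proof -
    have "i \<in> {1..n}" using that S by blast
    then show ?thesis by (intro integrable_indicator_mult[OF Eev measurable_phi abs_phi_le])
  qed
  have eq: "indicator E x * (\<Sum>i\<in>S. a i * \<phi> i x) = (\<Sum>i\<in>S. a i * (indicator E x * \<phi> i x))" for x
    by (simp add: sum_distrib_left ac_simps)
  have "T * prob E = (\<integral>x. T * indicator E x \<partial>M)"
    using Eev by simp
  also have "\<dots> \<le> (\<integral>x. (\<Sum>i\<in>S. a i * (indicator E x * \<phi> i x)) \<partial>M)"
  proof (intro integral_mono)
    show "integrable M (\<lambda>x. T * indicator E x)"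
      using Eev by (intro integrable_mult_right integrable_real_indicator) (auto simp: emeasure_eq_measure)
    show "integrable M (\<lambda>x. \<Sum>i\<in>S. a i * (indicator E x * \<phi> i x))"
      using intE by (intro Bochner_Integration.integrable_sum integrable_mult_right)
    show "T * indicator E x \<le> (\<Sum>i\<in>S. a i * (indicator E x * \<phi> i x))" for x
      unfolding eq[symmetric] by (simp add: E indicator_def)
  qed
  also have "\<dots> = (\<Sum>i\<in>S. \<integral>x. a i * (indicator E x * \<phi> i x) \<partial>M)"
    using intE by (intro Bochner_Integration.integral_sum integrable_mult_right)
  also have "\<dots> = prob E * (\<Sum>i\<in>S. a i * cond_coeff E i)"
    using u by (simp add: cond_coeff_def sum_distrib_left)
  finally have "T \<le> (\<Sum>i\<in>S. a i * cond_coeff E i)"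
    using u by (simp add: mult.commute)
  then have "T\<^sup>2 \<le> (\<Sum>i\<in>S. a i * cond_coeff E i)\<^sup>2"
    using T by (intro power_mono) auto
  also have "\<dots> \<le> (\<Sum>i\<in>S. (a i)\<^sup>2) * (\<Sum>i\<in>S. (cond_coeff E i)\<^sup>2)"
    by (rule Cauchy_Schwarz_ineq_sum)
  also have "\<dots> \<le> 1 * (\<Sum>i\<in>S. (cond_coeff E i)\<^sup>2)"
    using a by (intro mult_right_mono sum_nonneg) auto
  finally show ?thesis by simp
qed

lemma prob_superlevel_le:
  assumes S: "S \<subseteq> {1..n}" and a: "(\<Sum>i\<in>S. (a i)\<^sup>2) \<le> 1" and T: "0 < T"
    and A: "0 \<le> A" and B: "0 < B" and q: "1 \<le> q"
    and energy: "\<forall>E\<in>events. 0 < prob E \<longrightarrow>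
      (\<Sum>i\<in>S. (cond_coeff E i)\<^sup>2) \<le> A * (1 / prob E) + B * (1 + ln (1 / prob E))\<^sup>2"
  shows "prob {x \<in> space M. T \<le> \<bar>\<Sum>i\<in>S. a i * \<phi> i x\<bar>}
         \<le> 4 * A / T\<^sup>2 + 2 * (2 * B * q\<^sup>2) powr (q / 2) * T powr (- q)"
proof -
  have one: "prob {x \<in> space M. T \<le> (\<Sum>i\<in>S. b i * \<phi> i x)}
      \<le> 2 * A / T\<^sup>2 + (2 * B * q\<^sup>2) powr (q / 2) * T powr (- q)"
    if b: "(\<Sum>i\<in>S. (b i)\<^sup>2) \<le> 1" for b
  proof -
    define E where "E = {x \<in> space M. T \<le> (\<Sum>i\<in>S. b i * \<phi> i x)}"
    have Eev: "E \<in> events"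
      unfolding E_def using borel_measurable_sum_phi[OF S, of b] by measurable
    have "prob E \<le> 2 * A / T\<^sup>2 + (2 * B * q\<^sup>2) powr (q / 2) * T powr (- q)"
    proof (cases "0 < prob E")
      case True
      have "T\<^sup>2 \<le> A * (1 / prob E) + B * (1 + ln (1 / prob E))\<^sup>2"
        using superlevel_square_le[OF S b T E_def True] energy Eev True by fastforce
      then show ?thesis
        using T True q A B by (intro level_inversion) auto
    next
      case False
      then have "prob E = 0" using measure_nonneg[of M E] by linarith
      then show ?thesis using A by simp
    qed
    then show ?thesis by (simp add: E_def)
  qed
  let ?P = "{x \<in> space M. T \<le> (\<Sum>i\<in>S. a i * \<phi> i x)}"
  let ?N = "{x \<in> space M. T \<le> (\<Sum>i\<in>S. - a i * \<phi> i x)}"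
  have ev: "?P \<in> events" "?N \<in> events"
    using borel_measurable_sum_phi[OF S, of a] borel_measurable_sum_phi[OF S, of "\<lambda>i. - a i"]
    by measurable
  have "prob {x \<in> space M. T \<le> \<bar>\<Sum>i\<in>S. a i * \<phi> i x\<bar>} \<le> prob (?P \<union> ?N)"
    using ev by (intro finite_measure_mono) (auto simp: sum_negf)
  also have "\<dots> \<le> prob ?P + prob ?N"
    using ev by (intro measure_Un_le)
  also have "\<dots> \<le> 2 * (2 * A / T\<^sup>2 + (2 * B * q\<^sup>2) powr (q / 2) * T powr (- q))"
    using one[OF a] one[of "\<lambda>i. - a i"] a by simp
  finally show ?thesis by (simp add: algebra_simps)
qed

lemma abs_sum_phi_le:
  assumes S: "S \<subseteq> {1..n}" and a: "(\<Sum>i\<in>S. (a i)\<^sup>2) \<le> 1"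
  shows "\<bar>\<Sum>i\<in>S. a i * \<phi> i x\<bar> \<le> sqrt (card S)"
proof -
  have "(\<Sum>i\<in>S. a i * \<phi> i x)\<^sup>2 \<le> (\<Sum>i\<in>S. (a i)\<^sup>2) * (\<Sum>i\<in>S. (\<phi> i x)\<^sup>2)"
    by (rule Cauchy_Schwarz_ineq_sum)
  also have "\<dots> \<le> 1 * (\<Sum>i\<in>S. 1)"
  proof (intro mult_mono a sum_mono sum_nonneg)
    fix i assume "i \<in> S"
    then show "(\<phi> i x)\<^sup>2 \<le> 1" using abs_phi_le[of i x] S by (auto simp: abs_square_le_1)
  qed auto
  finally show ?thesis
    by (intro real_le_rsqrt) simp
qed

lemma moment_le:
  assumes p: "2 < p" and S: "S \<subseteq> {1..n}" "0 < card S" and a: "(\<Sum>i\<in>S. (a i)\<^sup>2) \<le> 1"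
    and A: "0 \<le> A" and B: "0 < B"
    and energy: "\<forall>E\<in>events. 0 < prob E \<longrightarrow>
      (\<Sum>i\<in>S. (cond_coeff E i)\<^sup>2) \<le> A * (1 / prob E) + B * (1 + ln (1 / prob E))\<^sup>2"
  shows "(\<integral>\<^sup>+ x. ennreal (\<bar>\<Sum>i\<in>S. a i * \<phi> i x\<bar> powr p) \<partial>M)
    \<le> ennreal (1 + 2 powr p * (2 powr (p - 2) / (2 powr (p - 2) - 1)) * (4 * A * sqrt (card S) powr (p - 2))
        + 2 powr p * (4 * (2 * B * (p + 1)\<^sup>2) powr ((p + 1) / 2)))"
proof -
  define h where "h x = \<bar>\<Sum>i\<in>S. a i * \<phi> i x\<bar>" for x
  define K where "K = 2 * (2 * B * (p + 1)\<^sup>2) powr ((p + 1) / 2)"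
  let ?b = "sqrt (card S)"
  have hm[measurable]: "h \<in> borel_measurable M"
    unfolding h_def[abs_def] using borel_measurable_sum_phi[OF S(1), of a] by measurable
  have hb: "0 \<le> h x" "h x \<le> ?b" for x
    using abs_sum_phi_le[OF S(1) a] by (auto simp: h_def)
  \<comment> \<open>The least \<open>J\<close> keeps the top level \<open>2\<^sup>J\<^sup>-\<^sup>1\<close> below \<open>sqrt (card S)\<close>.\<close>
  define J where "J = (LEAST J. ?b < 2 ^ J)"
  have "\<exists>J. ?b < 2 ^ J" by (rule real_arch_pow) simp
  then have J: "?b < 2 ^ J" unfolding J_def by (rule LeastI_ex)
  have b1: "1 \<le> ?b" using S(2) by simp
  have J0: "0 < J" using J b1 by (cases J) auto
  have J1: "2 ^ (J - 1) \<le> ?b"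
    using not_less_Least[of "J - 1" "\<lambda>J. ?b < 2 ^ J"] J0 unfolding J_def[symmetric] by simp
  have ev: "{x \<in> space M. 2 ^ j \<le> h x} \<in> events" for j :: nat by measurable
  have "(\<integral>\<^sup>+ x. ennreal (h x powr p) \<partial>M)
      \<le> (\<integral>\<^sup>+ x. ennreal (1 + (\<Sum>j<J. (2 ^ Suc j) powr p * of_bool (2 ^ j \<le> h x))) \<partial>M)"
    using hb J p by (intro nn_integral_mono ennreal_leI powr_le_dyadic_sum) (auto intro: le_less_trans)
  also have "\<dots> = (\<integral>\<^sup>+ x. ennreal (1 + (\<Sum>j<J. (2 ^ Suc j) powr p * indicator {x \<in> space M. 2 ^ j \<le> h x} x)) \<partial>M)"
    by (intro nn_integral_cong) (simp add: indicator_def of_bool_def)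
  also have "\<dots> = ennreal (\<integral>x. 1 + (\<Sum>j<J. (2 ^ Suc j) powr p * indicator {x \<in> space M. 2 ^ j \<le> h x} x) \<partial>M)"
  proof (intro nn_integral_eq_integral AE_I2)
    show "integrable M (\<lambda>x. 1 + (\<Sum>j<J. (2 ^ Suc j) powr p * indicator {x \<in> space M. 2 ^ j \<le> h x} x))"
      using ev
      by (intro Bochner_Integration.integrable_add Bochner_Integration.integrable_sum integrable_mult_right integrable_real_indicator)
         (auto simp: emeasure_eq_measure)
    show "0 \<le> 1 + (\<Sum>j<J. (2 ^ Suc j) powr p * indicator {x \<in> space M. 2 ^ j \<le> h x} x)" for x
      by (intro add_nonneg_nonneg sum_nonneg) auto
  qed
  also have "(\<integral>x. 1 + (\<Sum>j<J. (2 ^ Suc j) powr p * indicator {x \<in> space M. 2 ^ j \<le> h x} x) \<partial>M)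
      = 1 + (\<Sum>j<J. (2 ^ Suc j) powr p * prob {x \<in> space M. 2 ^ j \<le> h x})"
  proof -
    have int: "integrable M (\<lambda>x. (2 ^ Suc j) powr p * indicator {x \<in> space M. 2 ^ j \<le> h x} x)" for j :: nat
      using ev by (intro integrable_mult_right integrable_real_indicator) (auto simp: emeasure_eq_measure)
    have intS: "integrable M (\<lambda>x. \<Sum>j<J. (2 ^ Suc j) powr p * indicator {x \<in> space M. 2 ^ j \<le> h x} x)"
      using int by (intro Bochner_Integration.integrable_sum)
    have "(\<integral>x. 1 + (\<Sum>j<J. (2 ^ Suc j) powr p * indicator {x \<in> space M. 2 ^ j \<le> h x} x) \<partial>M)
        = 1 + (\<integral>x. (\<Sum>j<J. (2 ^ Suc j) powr p * indicator {x \<in> space M. 2 ^ j \<le> h x} x) \<partial>M)"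
      using Bochner_Integration.integral_add[OF integrable_const[of 1] intS] by (simp only: lebesgue_integral_const prob_space) simp
    also have "(\<integral>x. (\<Sum>j<J. (2 ^ Suc j) powr p * indicator {x \<in> space M. 2 ^ j \<le> h x} x) \<partial>M)
        = (\<Sum>j<J. \<integral>x. (2 ^ Suc j) powr p * indicator {x \<in> space M. 2 ^ j \<le> h x} x \<partial>M)"
      using int by (intro Bochner_Integration.integral_sum)
    also have "\<dots> = (\<Sum>j<J. (2 ^ Suc j) powr p * prob {x \<in> space M. 2 ^ j \<le> h x})"
      using ev by simp
    finally show ?thesis .
  qed
  also have "ennreal (1 + (\<Sum>j<J. (2 ^ Suc j) powr p * prob {x \<in> space M. 2 ^ j \<le> h x}))
      \<le> ennreal (1 + (\<Sum>j<J. (2 ^ Suc j) powr p * (4 * A / (2 ^ j)\<^sup>2 + K * (2 ^ j) powr (- (p + 1)))))"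
    unfolding h_def K_def using p
    by (intro ennreal_leI add_left_mono sum_mono mult_left_mono prob_superlevel_le S a A B energy) auto
  also have "\<dots> \<le> ennreal (1 + (2 powr p * (2 powr (p - 2) / (2 powr (p - 2) - 1)) * (4 * A * ?b powr (p - 2))
      + 2 powr p * (2 * K)))"
    using A B p J0 J1
    by (intro ennreal_leI add_left_mono dyadic_moment_sum_le) (auto simp: K_def)
  finally show ?thesis by (simp add: h_def K_def algebra_simps)
qed

end

section \<open>Constants depending on the exponent only\<close>

text \<open>The value of the bound in \<open>moment_le\<close> at \<open>B = 1500 / \<epsilon>\<close> with \<open>\<epsilon> = 1/2 - 1/p\<close>, where
\<open>4 * A * sqrt (card S) powr (p - 2)\<close> has been replaced by its bound \<open>1728 = 4 * 432\<close>.\<close>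

definition moment_constant :: "real \<Rightarrow> real" where
  "moment_constant p = 1 + 2 powr p * (2 powr (p - 2) / (2 powr (p - 2) - 1)) * 1728
     + 2 powr p * (4 * (3000 / (1 / 2 - 1 / p) * (p + 1)\<^sup>2) powr ((p + 1) / 2))"

lemma moment_constant_ge_1:
  assumes "2 < p"
  shows "1 \<le> moment_constant p"
proof -
  have "1 < 2 powr (p - 2)" using assms by simp
  then show ?thesis
    unfolding moment_constant_def by (intro add_increasing2) auto
qed

context bounded_orthogonal_family
begin

text \<open>This is where the size \<open>n\<^sup>2\<^sup>/\<^sup>p\<close> comes from. The sum is at most \<open>sqrt m\<close>, and at this height the density
term contributes \<open>(m / n) * (sqrt m)\<^sup>p\<^sup>-\<^sup>2 = m\<^sup>p\<^sup>/\<^sup>2 / n\<close> to the moment, which is at most \<open>1\<close> exactly when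
\<open>m \<le> n\<^sup>2\<^sup>/\<^sup>p\<close>.\<close>

lemma exists_subset_moment_le:
  assumes p: "2 < p" and n: "1 \<le> n" and m: "0 < m" "real m \<le> real n powr (2 / p)"
  shows "\<exists>S\<subseteq>{1..n}. card S = m \<and> (\<forall>a. (\<Sum>i\<in>S. (a i)\<^sup>2) \<le> 1 \<longrightarrow>
    (\<integral>\<^sup>+ x. ennreal (\<bar>\<Sum>i\<in>S. a i * \<phi> i x\<bar> powr p) \<partial>M) \<le> ennreal (moment_constant p))"
proof (cases "n = 1")
  case True
  \<comment> \<open>Here \<open>ln n = 0\<close>, so the selection argument gives nothing, but the sum has a single term.\<close>
  then have m1: "m = 1" using m by simp
  have "(\<integral>\<^sup>+ x. ennreal (\<bar>\<Sum>i\<in>{1..n}. a i * \<phi> i x\<bar> powr p) \<partial>M) \<le> ennreal (moment_constant p)"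
    if a: "(\<Sum>i\<in>{1..n}. (a i)\<^sup>2) \<le> 1" for a
  proof -
    have "\<bar>\<Sum>i\<in>{1..n}. a i * \<phi> i x\<bar> \<le> 1" for x
      using abs_sum_phi_le[OF order_refl a, of x] True by simp
    then have "\<bar>\<Sum>i\<in>{1..n}. a i * \<phi> i x\<bar> powr p \<le> 1 powr p" for x
      using p by (intro powr_mono2) auto
    then have "(\<integral>\<^sup>+ x. ennreal (\<bar>\<Sum>i\<in>{1..n}. a i * \<phi> i x\<bar> powr p) \<partial>M) \<le> (\<integral>\<^sup>+ x. ennreal 1 \<partial>M)"
      by (intro nn_integral_mono ennreal_leI) simp
    also have "\<dots> = ennreal 1" by (simp add: emeasure_space_1)
    also have "\<dots> \<le> ennreal (moment_constant p)"
      by (intro ennreal_leI moment_constant_ge_1 p)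
    finally show ?thesis .
  qed
  then show ?thesis using True m1 by (intro exI[of _ "{1..n}"]) auto
next
  case False
  then have n2: "2 \<le> n" using n by simp
  define \<epsilon> where "\<epsilon> = 1 / 2 - 1 / p"
  have \<epsilon>: "0 < \<epsilon>" "\<epsilon> \<le> 1" using p by (auto simp: \<epsilon>_def field_simps)
  have "1 - 2 * \<epsilon> = 2 / p" by (simp add: \<epsilon>_def)
  then have "real m \<le> real n powr (1 - 2 * \<epsilon>)" using m by simp
  from exists_subset_small_energy[OF n2 \<epsilon> this] obtain S
    where S: "S \<subseteq> {1..n}" "card S = m"
    and energy: "\<forall>E\<in>events. 0 < prob E \<longrightarrow> (\<Sum>i\<in>S. (cond_coeff E i)\<^sup>2)
      \<le> 432 * (m / n) * (1 / prob E) + 1500 / \<epsilon> * (1 + ln (1 / prob E))\<^sup>2"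
    by blast
  have r: "1 < 2 powr (p - 2)" using p by simp
  have density: "m / n * sqrt (card S) powr (p - 2) \<le> 1"
  proof -
    have "sqrt (card S) powr (p - 2) = real m powr (p / 2 - 1)"
      using S(2) by (simp add: powr_half_sqrt[symmetric] powr_powr diff_divide_distrib)
    then have "m / n * sqrt (card S) powr (p - 2) = real m powr (p / 2) / n"
      using m by (simp add: powr_diff)
    also have "\<dots> \<le> (real n powr (2 / p)) powr (p / 2) / n"
      using m p by (intro divide_right_mono powr_mono2) auto
    also have "\<dots> = 1" using n p by (simp add: powr_powr)
    finally show ?thesis .
  qed
  have "(\<integral>\<^sup>+ x. ennreal (\<bar>\<Sum>i\<in>S. a i * \<phi> i x\<bar> powr p) \<partial>M) \<le> ennreal (moment_constant p)"
    if a: "(\<Sum>i\<in>S. (a i)\<^sup>2) \<le> 1" for a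
  proof -
    have "4 * (432 * (m / n)) * sqrt (card S) powr (p - 2) \<le> 1728"
      using density by (simp add: mult.assoc)
    then have "2 powr p * (2 powr (p - 2) / (2 powr (p - 2) - 1)) * (4 * (432 * (m / n)) * sqrt (card S) powr (p - 2))
        \<le> 2 powr p * (2 powr (p - 2) / (2 powr (p - 2) - 1)) * 1728"
      using r by (intro mult_left_mono) auto
    then have le: "ennreal (1 + 2 powr p * (2 powr (p - 2) / (2 powr (p - 2) - 1)) * (4 * (432 * (m / n)) * sqrt (card S) powr (p - 2))
        + 2 powr p * (4 * (2 * (1500 / \<epsilon>) * (p + 1)\<^sup>2) powr ((p + 1) / 2))) \<le> ennreal (moment_constant p)"
      unfolding moment_constant_def \<epsilon>_def by (intro ennreal_leI) simp
    have pos: "0 < card S" "0 \<le> 432 * (real m / real n)" "0 < 1500 / \<epsilon>"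
      using S m \<epsilon> by auto
    show ?thesis
      by (rule order_trans[OF moment_le[OF p S(1) pos(1) a pos(2,3) energy] le])
  qed
  then show ?thesis using S by blast
qed

end

lemma Lp_norm_le:
  assumes p: "0 < p" and D: "0 \<le> D"
    and le: "(\<integral>\<^sup>+ x. ennreal (\<bar>f x\<bar> powr p) \<partial>M) \<le> ennreal (D powr p)"
  shows "Lp_norm M p f \<le> ennreal D"
proof -
  let ?I = "\<integral>\<^sup>+ x. ennreal (\<bar>f x\<bar> powr p) \<partial>M"
  have fin: "?I \<noteq> \<infinity>" using le by (auto simp: top_unique)
  have "enn2real ?I \<le> D powr p"
    using le by (metis enn2real_mono enn2real_ennreal ennreal_less_top powr_ge_zero)
  then have "enn2real ?I powr (1 / p) \<le> (D powr p) powr (1 / p)"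
    using p by (intro powr_mono2) auto
  also have "\<dots> = D" using p D by (simp add: powr_powr)
  finally show ?thesis
    using fin by (simp add: Lp_norm_def Let_def ennreal_leI)
qed

lemma Linf_norm_le_1_iff:
  assumes "f \<in> borel_measurable M"
  shows "Linf_norm M f \<le> 1 \<longleftrightarrow> (AE x in M. \<bar>f x\<bar> \<le> 1)"
proof
  assume le: "Linf_norm M f \<le> 1"
  show "AE x in M. \<bar>f x\<bar> \<le> 1"
    using esssup_AE[of "\<lambda>x. ennreal \<bar>f x\<bar>" M]
  proof eventually_elim
    case (elim x)
    then have "ennreal \<bar>f x\<bar> \<le> 1"
      using le unfolding Linf_norm_def by (rule order_trans)
    then show ?case by simp
  qed
next
  assume "AE x in M. \<bar>f x\<bar> \<le> 1"
  then show "Linf_norm M f \<le> 1"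
    unfolding Linf_norm_def using assms by (intro esssup_I) auto
qed

text \<open>The essential bound holds pointwise after a change on a null set, which affects neither
orthogonality nor norms.\<close>

lemma bounded_orthogonal_system_clip:
  assumes M: "prob_space M" and \<phi>: "bounded_orthogonal_system n M \<phi>"
  shows "bounded_orthogonal_family M n (\<lambda>i x. max (- 1) (min 1 (\<phi> i x)))"
    and "AE x in M. \<forall>i\<in>{1..n}. max (- 1) (min 1 (\<phi> i x)) = \<phi> i x"
proof -
  have meas: "\<phi> i \<in> borel_measurable M" if "i \<in> {1..n}" for i
    using \<phi> that by (simp add: bounded_orthogonal_system_def)
  have "AE x in M. \<bar>\<phi> i x\<bar> \<le> 1" if "i \<in> {1..n}" for i
    using \<phi> that Linf_norm_le_1_iff[OF meas[OF that]] by (simp add: bounded_orthogonal_system_def)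
  then have "AE x in M. \<forall>i\<in>{1..n}. \<bar>\<phi> i x\<bar> \<le> 1"
    by (intro AE_finite_allI) auto
  then show AE: "AE x in M. \<forall>i\<in>{1..n}. max (- 1) (min 1 (\<phi> i x)) = \<phi> i x"
    by eventually_elim (auto simp: abs_le_iff max_def min_def)
  interpret prob_space M by (rule M)
  show "bounded_orthogonal_family M n (\<lambda>i x. max (- 1) (min 1 (\<phi> i x)))"
  proof
    fix i j assume ij: "i \<in> {1..n}" "j \<in> {1..n}" "i \<noteq> j"
    have "(\<integral>x. max (- 1) (min 1 (\<phi> i x)) * max (- 1) (min 1 (\<phi> j x)) \<partial>M) = (\<integral>x. \<phi> i x * \<phi> j x \<partial>M)"
    proof (rule integral_cong_AE)
      show "AE x in M. max (- 1) (min 1 (\<phi> i x)) * max (- 1) (min 1 (\<phi> j x)) = \<phi> i x * \<phi> j x"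
        using AE by eventually_elim (use ij in auto)
    qed (use meas[OF ij(1)] meas[OF ij(2)] in measurable)
    then show "(\<integral>x. max (- 1) (min 1 (\<phi> i x)) * max (- 1) (min 1 (\<phi> j x)) \<partial>M) = 0"
      using \<phi> ij by (simp add: bounded_orthogonal_system_def)
  qed (use meas in auto)
qed

text \<open>The case \<open>\<Sum>i\<in>S. (a i)\<^sup>2 \<le> 1\<close> gives the general one by homogeneity. The lower bound on \<open>card S = \<lfloor>n\<^sup>2\<^sup>/\<^sup>p\<rfloor>\<close>
uses \<open>\<lfloor>x\<rfloor> \<ge> x / 2\<close> for \<open>x \<ge> 1\<close>.\<close>

theorem exists_Lambda_p_constants:
  assumes p: "2 < p"
  shows "\<exists>c C. 0 < c \<and> c \<le> C \<and> Lambda_p_constants TYPE('a) p c C"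
proof (intro exI conjI)
  define C where "C = moment_constant p powr (1 / p)"
  have C: "1 \<le> C"
    using p moment_constant_ge_1[OF p] by (simp add: C_def ge_one_powr_ge_zero)
  show "0 < (1 / 2 :: real)" by simp
  show "1 / 2 \<le> C" using C by simp
  show "Lambda_p_constants TYPE('a) p (1 / 2) C"
    unfolding Lambda_p_constants_def
  proof (intro allI impI)
    fix n :: nat and M :: "'a measure" and \<phi> :: "nat \<Rightarrow> 'a \<Rightarrow> real"
    assume M: "prob_space M" and \<phi>: "bounded_orthogonal_system n M \<phi>"
    let ?N = "real n powr (2 / p)"
    show "\<exists>S\<subseteq>{1..n}. 1 / 2 * ?N \<le> real (card S) \<and> real (card S) \<le> C * ?N \<and>
        (\<forall>a. Lp_norm M p (\<lambda>x. \<Sum>i\<in>S. a i * \<phi> i x) \<le> ennreal (C * sqrt (\<Sum>i\<in>S. \<bar>a i\<bar>\<^sup>2)))"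
    proof (cases "n = 0")
      case True
      then show ?thesis using p by (auto simp: Lp_norm_def)
    next
      case False
      define m where "m = nat \<lfloor>?N\<rfloor>"
      have N1: "1 \<le> ?N" using False p by (intro ge_one_powr_ge_zero) auto
      then have m: "0 < m" "real m \<le> ?N" "?N < real m + 1" by (auto simp: m_def)
      define \<psi> where "\<psi> = (\<lambda>i x. max (- 1) (min 1 (\<phi> i x)))"
      interpret bounded_orthogonal_family M n \<psi>
        unfolding \<psi>_def by (rule bounded_orthogonal_system_clip(1)[OF M \<phi>])
      obtain S where S: "S \<subseteq> {1..n}" "card S = m"
        and moment: "\<And>a. (\<Sum>i\<in>S. (a i)\<^sup>2) \<le> 1 \<Longrightarrow>
          (\<integral>\<^sup>+ x. ennreal (\<bar>\<Sum>i\<in>S. a i * \<psi> i x\<bar> powr p) \<partial>M) \<le> ennreal (moment_constant p)"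
        using exists_subset_moment_le[OF p _ m(1,2)] False by auto
      have finS: "finite S" using S finite_subset by blast
      have "Lp_norm M p (\<lambda>x. \<Sum>i\<in>S. a i * \<phi> i x) \<le> ennreal (C * sqrt (\<Sum>i\<in>S. \<bar>a i\<bar>\<^sup>2))" for a
      proof (rule Lp_norm_le)
        define R where "R = sqrt (\<Sum>i\<in>S. \<bar>a i\<bar>\<^sup>2)"
        have R: "0 \<le> R" by (simp add: R_def sum_nonneg)
        have R2: "R\<^sup>2 = (\<Sum>i\<in>S. (a i)\<^sup>2)" by (simp add: R_def sum_nonneg)
        define b where "b i = a i / R" for i
        have b: "(\<Sum>i\<in>S. (b i)\<^sup>2) \<le> 1"
          by (simp add: b_def power_divide R2 flip: sum_divide_distrib)
        have ab: "a i = R * b i" if "i \<in> S" for i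
        proof (cases "R = 0")
          case True
          then have "(a i)\<^sup>2 = 0"
            using R2 finS that by (simp add: sum_nonneg_eq_0_iff)
          then show ?thesis using True by simp
        qed (simp add: b_def)
        have "(\<integral>\<^sup>+ x. ennreal (\<bar>\<Sum>i\<in>S. a i * \<phi> i x\<bar> powr p) \<partial>M)
            = (\<integral>\<^sup>+ x. ennreal (R powr p) * ennreal (\<bar>\<Sum>i\<in>S. b i * \<psi> i x\<bar> powr p) \<partial>M)"
        proof (rule nn_integral_cong_AE)
          show "AE x in M. ennreal (\<bar>\<Sum>i\<in>S. a i * \<phi> i x\<bar> powr p)
              = ennreal (R powr p) * ennreal (\<bar>\<Sum>i\<in>S. b i * \<psi> i x\<bar> powr p)"
            using bounded_orthogonal_system_clip(2)[OF M \<phi>]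
          proof eventually_elim
            case (elim x)
            have "(\<Sum>i\<in>S. a i * \<phi> i x) = R * (\<Sum>i\<in>S. b i * \<psi> i x)"
              unfolding sum_distrib_left using elim S(1) ab
              by (intro sum.cong refl) (auto simp: \<psi>_def)
            then show ?case
              using R by (simp add: abs_mult powr_mult ennreal_mult')
          qed
        qed
        also have "\<dots> = ennreal (R powr p) * (\<integral>\<^sup>+ x. ennreal (\<bar>\<Sum>i\<in>S. b i * \<psi> i x\<bar> powr p) \<partial>M)"
        proof (rule nn_integral_cmult)
          define g where "g = (\<lambda>x. \<Sum>i\<in>S. b i * \<psi> i x)"
          have [measurable]: "g \<in> borel_measurable M"
            unfolding g_def by (rule borel_measurable_sum_phi[OF S(1)])
          have "(\<lambda>x. ennreal (\<bar>g x\<bar> powr p)) \<in> borel_measurable M" by measurable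
          then show "(\<lambda>x. ennreal (\<bar>\<Sum>i\<in>S. b i * \<psi> i x\<bar> powr p)) \<in> borel_measurable M"
            by (simp add: g_def)
        qed
        also have "\<dots> \<le> ennreal (R powr p) * ennreal (moment_constant p)"
          by (intro mult_left_mono moment b) auto
        also have "\<dots> = ennreal ((C * R) powr p)"
        proof -
          have "C powr p = moment_constant p"
            using p moment_constant_ge_1[OF p] by (simp add: C_def powr_powr)
          then show ?thesis
            using R C moment_constant_ge_1[OF p] by (simp add: powr_mult mult.commute ennreal_mult)
        qed
        finally show "(\<integral>\<^sup>+ x. ennreal (\<bar>\<Sum>i\<in>S. a i * \<phi> i x\<bar> powr p) \<partial>M)
            \<le> ennreal ((C * sqrt (\<Sum>i\<in>S. \<bar>a i\<bar>\<^sup>2)) powr p)"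
          by (simp add: R_def)
        show "0 \<le> C * sqrt (\<Sum>i\<in>S. \<bar>a i\<bar>\<^sup>2)" using C by (simp add: sum_nonneg)
      qed (use p in simp)
      moreover have "1 / 2 * ?N \<le> real (card S)" using m S(2) by linarith
      moreover have "real (card S) \<le> C * ?N"
        using m S(2) mult_right_mono[of 1 C ?N] C N1 by simp
      ultimately show ?thesis using S(1) by blast
    qed
  qed
qed

text \<open>The assertion depends only on the joint distribution of the system, which lives on \<open>nat \<Rightarrow> real\<close>:
the coordinate functions under the push-forward measure form a system with the same norms and inner
products.\<close>

lemma Lambda_p_constants_transfer:
  assumes L: "Lambda_p_constants TYPE(nat \<Rightarrow> real) p c C"
  shows "Lambda_p_constants TYPE('a) p c C"
  unfolding Lambda_p_constants_def
proof (intro allI impI)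
  fix n :: nat and M :: "'a measure" and \<phi> :: "nat \<Rightarrow> 'a \<Rightarrow> real"
  assume M: "prob_space M" and \<phi>: "bounded_orthogonal_system n M \<phi>"
  interpret prob_space M by (rule M)
  define P where "P = (PiM UNIV (\<lambda>_. borel) :: (nat \<Rightarrow> real) measure)"
  define J where "J x = (\<lambda>j. if j \<in> {1..n} then \<phi> j x else 0)" for x
  define N where "N = distr M P J"
  have meas: "\<phi> j \<in> borel_measurable M" if "j \<in> {1..n}" for j
    using \<phi> that by (simp add: bounded_orthogonal_system_def)
  have J: "J \<in> measurable M P"
    unfolding P_def J_def[abs_def]
  proof (rule measurable_PiM_single')
    show "(\<lambda>x. if j \<in> {1..n} then \<phi> j x else 0) \<in> borel_measurable M" for j
      using meas[of j] by (cases "j \<in> {1..n}") (simp_all only: if_True if_False borel_measurable_const)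
  qed simp
  have coord: "(\<lambda>\<omega>. \<omega> j) \<in> borel_measurable P" for j
    unfolding P_def by (rule measurable_component_singleton) simp
  have coordN: "(\<lambda>\<omega>. \<omega> j) \<in> borel_measurable N" for j
    using coord by (simp add: N_def)
  have "prob_space N" unfolding N_def by (rule prob_space_distr[OF J])
  moreover have "bounded_orthogonal_system n N (\<lambda>j \<omega>. \<omega> j)"
    unfolding bounded_orthogonal_system_def
  proof (intro conjI ballI impI coordN)
    fix j assume j: "j \<in> {1..n}"
    have "AE x in M. \<bar>J x j\<bar> \<le> 1"
      using \<phi> j Linf_norm_le_1_iff[OF meas[OF j]] by (simp add: bounded_orthogonal_system_def J_def)
    moreover have "{\<omega> \<in> space P. \<bar>\<omega> j\<bar> \<le> 1} \<in> sets P" using coord[of j] by measurable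
    ultimately have "AE \<omega> in N. \<bar>\<omega> j\<bar> \<le> 1"
      unfolding N_def by (subst AE_distr_iff[OF J])
    then show "Linf_norm N (\<lambda>\<omega>. \<omega> j) \<le> 1"
      using Linf_norm_le_1_iff[OF coordN] by simp
  next
    fix i j assume ij: "i \<in> {1..n}" "j \<in> {1..n}" "i \<noteq> j"
    have "(\<integral>\<omega>. \<omega> i * \<omega> j \<partial>N) = (\<integral>x. J x i * J x j \<partial>M)"
      unfolding N_def using coord[of i] coord[of j] by (intro integral_distr J) measurable
    then show "(\<integral>\<omega>. \<omega> i * \<omega> j \<partial>N) = 0"
      using \<phi> ij by (simp add: bounded_orthogonal_system_def J_def)
  qed
  ultimately obtain S where S: "S \<subseteq> {1..n}" "c * real n powr (2 / p) \<le> real (card S)"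
      "real (card S) \<le> C * real n powr (2 / p)"
      "\<And>a. Lp_norm N p (\<lambda>\<omega>. \<Sum>i\<in>S. a i * \<omega> i) \<le> ennreal (C * sqrt (\<Sum>i\<in>S. \<bar>a i\<bar>\<^sup>2))"
    using L unfolding Lambda_p_constants_def by blast
  have "Lp_norm N p (\<lambda>\<omega>. \<Sum>i\<in>S. a i * \<omega> i) = Lp_norm M p (\<lambda>x. \<Sum>i\<in>S. a i * \<phi> i x)" for a
  proof -
    have "(\<integral>\<^sup>+ \<omega>. ennreal (\<bar>\<Sum>i\<in>S. a i * \<omega> i\<bar> powr p) \<partial>N)
        = (\<integral>\<^sup>+ x. ennreal (\<bar>\<Sum>i\<in>S. a i * J x i\<bar> powr p) \<partial>M)"
    proof -
      define g where "g = (\<lambda>\<omega>. \<Sum>i\<in>S. a i * \<omega> i :: real)"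
      have [measurable]: "g \<in> borel_measurable P"
        unfolding g_def using coord by (intro borel_measurable_sum borel_measurable_times borel_measurable_const)
      have "(\<lambda>\<omega>. ennreal (\<bar>g \<omega>\<bar> powr p)) \<in> borel_measurable P" by measurable
      then show ?thesis
        unfolding N_def g_def by (subst nn_integral_distr[OF J]) simp_all
    qed
    also have "\<dots> = (\<integral>\<^sup>+ x. ennreal (\<bar>\<Sum>i\<in>S. a i * \<phi> i x\<bar> powr p) \<partial>M)"
    proof -
      have "(\<Sum>i\<in>S. a i * J x i) = (\<Sum>i\<in>S. a i * \<phi> i x)" for x
        using S(1) by (intro sum.cong refl) (auto simp: J_def)
      then show ?thesis by simp
    qed
    finally show ?thesis by (simp add: Lp_norm_def)
  qed
  then show "\<exists>S\<subseteq>{1..n}. c * real n powr (2 / p) \<le> real (card S) \<and>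
      real (card S) \<le> C * real n powr (2 / p) \<and>
      (\<forall>a. Lp_norm M p (\<lambda>x. \<Sum>i\<in>S. a i * \<phi> i x) \<le> ennreal (C * sqrt (\<Sum>i\<in>S. \<bar>a i\<bar>\<^sup>2)))"
    using S by (intro exI[of _ S]) simp
qed

theorem theorem1p3:
  fixes p :: real
  assumes "p > 2"
  shows "(\<exists>c C. 0 < c \<and> c \<le> C \<and> Lambda_p_constants TYPE(nat \<Rightarrow> real) p c C) \<and>
         (\<forall>c C. 0 < c \<and> c \<le> C \<and> Lambda_p_constants TYPE(nat \<Rightarrow> real) p c C \<longrightarrow>
                Lambda_p_constants TYPE('a) p c C)"
  using exists_Lambda_p_constants[OF assms] Lambda_p_constants_transfer by blast

end
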